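(* For every $\tau\in\mathbb{H}^2$ set $$f(\tau)=\frac{11+5\sqrt5}{2}\prod_{n=1}^{\infty}\frac{\left(1+\frac{1+\sqrt5}{2}q^n+q^{2n}\right)^5}{\left(1+\frac{1-\sqrt5}{2}q^n+q^{2n}\right)^5},\qquad q=\exp(2\pi i\tau),$$ and $$T(\tau)=\frac{\sqrt{250+110\sqrt5}}{5}\prod_{n=1}^{\infty}\frac{(1-q^n)^5}{(1-q^{5n})^3}\left(1+\frac{1+\sqrt5}{2}q^n+q^{2n}\right)^5 .$$ Then the inverse function $\tau=\tau(f)$ yields $T(f)=T(\tau(f))$, and $T(f)$ satisfies the differential equation $$\frac{d^2T}{df^2}+\left\{-\frac1f+\frac{1}{f-\frac{11+5\sqrt5}{2}}+\frac{1}{f-\frac{11-5\sqrt5}{2}}\right\}\frac{dT}{df}-\frac{3f+1}{f^2\left(f-\frac{11+5\sqrt5}{2}\right)\left(f-\frac{11-5\sqrt5}{2}\right)}\,T=0 .$$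
   Context: $\mathbb{H}^2=\{\tau\in\mathbb{C}\mid \Im\tau>0\}$. The inverse function $\tau=\tau(f)$ means any local holomorphic inverse of $\tau\mapsto f(\tau)$; thus $T$ is regarded locally as a function of the variable $f$. *)

theory Defs
  imports "HOL-Complex_Analysis.Complex_Analysis"
begin

definition upper_half_plane :: "complex set" where
  "upper_half_plane = {\<tau>. Im \<tau> > 0}"

definition nome :: "complex \<Rightarrow> complex" where
  "nome \<tau> = exp (2 * of_real pi * \<i> * \<tau>)"

definition root_plus :: complex where
  "root_plus = of_real ((11 + 5 * sqrt 5) / 2)"

definition root_minus :: complex where
  "root_minus = of_real ((11 - 5 * sqrt 5) / 2)"

(* The library's infinite products start at index 0, hence Suc n for the factor with index n >= 1.
   The functions f and T below are meaningful on the upper half plane only. *)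

definition f_fun :: "complex \<Rightarrow> complex" where
  "f_fun \<tau> = (let q = nome \<tau> in
     root_plus *
     (\<Prod>n. (1 + of_real ((1 + sqrt 5) / 2) * q ^ Suc n + q ^ (2 * Suc n)) ^ 5
         / (1 + of_real ((1 - sqrt 5) / 2) * q ^ Suc n + q ^ (2 * Suc n)) ^ 5))"

definition T_fun :: "complex \<Rightarrow> complex" where
  "T_fun \<tau> = (let q = nome \<tau> in
     of_real (sqrt (250 + 110 * sqrt 5) / 5) *
     (\<Prod>n. (1 - q ^ Suc n) ^ 5 / (1 - q ^ (5 * Suc n)) ^ 3
         * (1 + of_real ((1 + sqrt 5) / 2) * q ^ Suc n + q ^ (2 * Suc n)) ^ 5))"

definition local_holomorphic_inverse ::
  "(complex \<Rightarrow> complex) \<Rightarrow> complex set \<Rightarrow> complex set \<Rightarrow> (complex \<Rightarrow> complex) \<Rightarrow> bool" where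
  "local_holomorphic_inverse h D U g \<longleftrightarrow>
     open U \<and> g holomorphic_on U \<and> g ` U \<subseteq> D \<and> (\<forall>w\<in>U. h (g w) = w)"

end

theory Submission
  imports Defs
begin

text \<open>The functions \<open>f\<close> and \<open>T\<close> are built from theta values at the points of order five, and everything
follows from two classical relations between logarithmic derivatives of the theta function.
Write \<open>D = q d/dq\<close>. For \<open>X\<close> on the unit circle let
\<open>\<rho>(X) = (1 + X) / (2 (1 - X)) + \<Sum>a\<ge>1. q^a / (1 - q^a) * (X^a - X^(-a))\<close>,
which is, up to sign, the logarithmic derivative of the Jacobi theta function under \<open>X d/dX\<close>, and let
\<open>\<rho>\<^sub>1\<close>, \<open>\<rho>\<^sub>2\<close>, \<open>\<rho>\<^sub>3\<close> be its iterated derivatives under \<open>X d/dX\<close>. The two relations are an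
evaluation of \<open>\<rho>(X) \<rho>(Y) + \<rho>(Y) \<rho>(Z) + \<rho>(Z) \<rho>(X)\<close> for \<open>X Y Z = 1\<close>, due to the addition theorem of
elliptic functions (\<open>rho_triple\<close>), and an evaluation of \<open>\<rho>(X)\<^sup>2\<close> due to Ramanujan that amounts to the heat
equation of the theta function (\<open>rho_square\<close>). Both are proved at once, without elliptic functions, by
rearranging an absolutely convergent double series: with \<open>\<lambda>(a) = q^a / (1 - q^a)\<close> the identity
\<open>\<lambda>(a) \<lambda>(b) = \<lambda>(a + b) (1 + \<lambda>(a) + \<lambda>(b))\<close> expresses the sum of \<open>g(a,b) \<lambda>(a) \<lambda>(b)\<close> by sums of the same
kind with \<open>g\<close> transformed by a Euclidean step on \<open>(a, b)\<close>, and for a suitable symmetric choice of \<open>g\<close>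
all double sums cancel except for their diagonals (\<open>triple_identity_coefficients\<close>).

Putting \<open>Y = X\<close> in the first relation gives a duplication formula. This formula and the heat equation are
differentiated twice along the circle and then evaluated at \<open>X = \<zeta>\<close> and \<open>X = \<zeta>\<^sup>2\<close> for a primitive fifth
root of unity \<open>\<zeta>\<close>. Since \<open>\<zeta>\<^sup>4 = 1/\<zeta>\<close>, doubling twice returns to the start, and the resulting linear
equations express all derivatives of \<open>\<rho>\<close> at these two points by \<open>a = \<rho>(\<zeta>)\<close>, \<open>b = \<rho>(\<zeta>\<^sup>2)\<close> and one
quasimodular quantity (\<open>quintic_relations\<close>). As the heat equation converts \<open>D\<close> into derivatives along
the circle, a closed differential system results. In terms of \<open>u = 3 a + b\<close> and
\<open>v = 3 b - a\<close> it reads \<open>D u = u y\<close>, \<open>D v = v (y + (u\<^sup>2 + 11 u v - v\<^sup>2) / 5)\<close> and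
\<open>D y = y\<^sup>2 - (3 u v - v\<^sup>2) (u\<^sup>2 + 11 u v - v\<^sup>2) / 25\<close> (\<open>derivatives\<close>).

The logarithm of each infinite product is a Lambert series, and the product defining \<open>T\<close> has the
logarithmic derivative \<open>y\<close> as well. Hence \<open>T\<close> is a constant multiple of \<open>u\<close>; the same argument for
\<open>\<zeta>\<^sup>2\<close> in place of \<open>\<zeta>\<close> applies to \<open>v\<close>, and \<open>f = - u / v\<close>. Then \<open>u\<^sup>2 + 11 u v - v\<^sup>2 = v\<^sup>2 (f\<^sup>2 - 11 f - 1)\<close>,
and the roots of \<open>f\<^sup>2 - 11 f - 1\<close> are the two numbers \<open>(11 \<plusminus> 5 \<surd>5) / 2\<close>. The system gives
\<open>D f\<close>, then \<open>dT/df\<close> as a rational expression in \<open>u\<close>, \<open>y\<close> and \<open>f\<close>, and differentiating once more the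
differential equation becomes a rational identity in which \<open>y\<close> cancels (\<open>ode_cancellation\<close>).\<close>

section \<open>Lambert series\<close>

text \<open>For \<open>a > 0\<close> this is \<open>\<Sum>n\<ge>1. q^(a n)\<close>, and \<open>lam2\<close> below is \<open>\<Sum>n\<ge>1. n q^(a n)\<close>. Division by zero makes
both vanish at \<open>a = 0\<close>, so that series over all natural numbers have no term there.\<close>

definition lam :: "complex \<Rightarrow> nat \<Rightarrow> complex" where
  "lam q a = q ^ a / (1 - q ^ a)"

definition lam2 :: "complex \<Rightarrow> nat \<Rightarrow> complex" where
  "lam2 q a = q ^ a / (1 - q ^ a)\<^sup>2"

text \<open>The power series with these coefficients has radius of convergence at least one. This
makes the Lambert series converge in the whole unit disc, and it is stable under multiplication of the
coefficients by the index, that is, under differentiation.\<close>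

definition subexp :: "(nat \<Rightarrow> complex) \<Rightarrow> bool" where
  "subexp c \<longleftrightarrow> (\<forall>r. 0 < r \<longrightarrow> r < 1 \<longrightarrow> summable (\<lambda>a. norm (c a) * r ^ a))"

definition lambert :: "(nat \<Rightarrow> complex) \<Rightarrow> complex \<Rightarrow> complex" where
  "lambert c q = (\<Sum>a. c a * lam q a)"

definition lambert2 :: "(nat \<Rightarrow> complex) \<Rightarrow> complex \<Rightarrow> complex" where
  "lambert2 c q = (\<Sum>a. c a * lam2 q a)"

lemma lam_0 [simp]: "lam q 0 = 0"
  by (simp add: lam_def)

lemma one_minus_power_lower:
  fixes q :: complex
  assumes "norm q < 1" "a > 0"
  shows "norm (1 - q ^ a) \<ge> 1 - norm q"
proof -
  have "norm (q ^ a) \<le> norm q"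
    using assms power_decreasing[of 1 a "norm q"] unfolding norm_power by simp
  moreover have "norm (1 - q ^ a) \<ge> norm (1::complex) - norm (q ^ a)"
    by (rule norm_triangle_ineq2)
  ultimately show ?thesis by simp
qed

lemma one_minus_power_nonzero:
  fixes q :: complex
  assumes "norm q < 1" "a > 0"
  shows "1 - q ^ a \<noteq> 0"
  using one_minus_power_lower[OF assms] assms by auto

lemma norm_lam_le:
  assumes "norm q < 1"
  shows "norm (lam q a) \<le> norm q ^ a / (1 - norm q)"
proof (cases "a = 0")
  case False
  then show ?thesis
    using one_minus_power_lower[OF assms, of a] assms
    by (auto simp: lam_def norm_divide norm_power intro!: divide_left_mono mult_pos_pos)
qed (use assms in auto)

lemma norm_lam2_le:
  assumes "norm q < 1"
  shows "norm (lam2 q a) \<le> norm q ^ a / (1 - norm q)\<^sup>2"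
proof (cases "a = 0")
  case False
  then show ?thesis
    using one_minus_power_lower[OF assms, of a] assms
    by (auto simp: lam2_def norm_divide norm_power
        intro!: divide_left_mono mult_pos_pos power_mono)
qed (use assms in \<open>auto simp: lam2_def\<close>)

text \<open>This replaces the usual splitting of a fourfold sum over \<open>q^(a m + b n)\<close> according to \<open>m < n\<close>, \<open>m = n\<close> and
\<open>m > n\<close>; the three cases correspond to the summands \<open>lam q b\<close>, \<open>1\<close> and \<open>lam q a\<close>.\<close>

lemma lam_mult:
  assumes "norm q < 1" "a > 0" "b > 0"
  shows "lam q a * lam q b = lam q (a + b) * (1 + lam q a + lam q b)"
proof -
  have nz: "1 - q ^ a \<noteq> 0" "1 - q ^ b \<noteq> 0" "1 - q ^ a * q ^ b \<noteq> 0"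
    using assms one_minus_power_nonzero[of q a] one_minus_power_nonzero[of q b]
      one_minus_power_nonzero[of q "a + b"] by (auto simp: power_add)
  show ?thesis
    unfolding lam_def power_add using nz by (simp add: divide_simps) algebra
qed

lemma lam2_eq:
  assumes "norm q < 1"
  shows "lam2 q a = lam q a + (lam q a)\<^sup>2"
proof (cases "a = 0")
  case False
  then have "1 - q ^ a \<noteq> 0" by (intro one_minus_power_nonzero assms) auto
  then show ?thesis by (simp add: lam_def lam2_def divide_simps power2_eq_square) algebra
qed (simp add: lam2_def)

lemma subexp_bounded:
  assumes "\<And>a. norm (c a) \<le> C"
  shows "subexp c"
  unfolding subexp_def
proof (intro allI impI)
  fix r :: real assume r: "0 < r" "r < 1"
  have "summable (\<lambda>a. C * r ^ a)" using r by (intro summable_mult summable_geometric) auto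
  then show "summable (\<lambda>a. norm (c a) * r ^ a)"
    by (rule summable_comparison_test') (use assms r in \<open>auto intro!: mult_right_mono\<close>)
qed

lemma subexp_comparison:
  assumes "subexp c" "\<And>a. norm (d a) \<le> C * norm (c a)"
  shows "subexp d"
  unfolding subexp_def
proof (intro allI impI)
  fix r :: real assume r: "0 < r" "r < 1"
  have "summable (\<lambda>a. C * (norm (c a) * r ^ a))"
    using assms(1) r by (intro summable_mult) (auto simp: subexp_def)
  then show "summable (\<lambda>a. norm (d a) * r ^ a)"
  proof (rule summable_comparison_test'[where N = 0])
    fix a
    show "norm (norm (d a) * r ^ a) \<le> C * (norm (c a) * r ^ a)"
      using mult_right_mono[OF assms(2)[of a], of "r ^ a"] r by (simp add: mult_ac)
  qed
qed

lemma subexp_add [intro]: "subexp c \<Longrightarrow> subexp d \<Longrightarrow> subexp (\<lambda>a. c a + d a)"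
  unfolding subexp_def
proof (intro allI impI)
  fix r :: real assume *: "\<forall>r>0. r < 1 \<longrightarrow> summable (\<lambda>a. norm (c a) * r ^ a)"
    "\<forall>r>0. r < 1 \<longrightarrow> summable (\<lambda>a. norm (d a) * r ^ a)" and r: "0 < r" "r < 1"
  have "summable (\<lambda>a. norm (c a) * r ^ a + norm (d a) * r ^ a)"
    using * r by (intro summable_add) auto
  then show "summable (\<lambda>a. norm (c a + d a) * r ^ a)"
  proof (rule summable_comparison_test'[where N = 0])
    fix a
    show "norm (norm (c a + d a) * r ^ a) \<le> norm (c a) * r ^ a + norm (d a) * r ^ a"
      using mult_right_mono[OF norm_triangle_ineq[of "c a" "d a"], of "r ^ a"] r
      by (simp add: algebra_simps)
  qed
qed

lemma subexp_cmult [intro]: "subexp c \<Longrightarrow> subexp (\<lambda>a. k * c a)"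
  by (rule subexp_comparison[where C = "norm k"]) (auto simp: norm_mult)

lemma subexp_uminus [intro]: "subexp c \<Longrightarrow> subexp (\<lambda>a. - c a)"
  by (rule subexp_comparison[where C = 1]) auto

lemma subexp_diff [intro]: "subexp c \<Longrightarrow> subexp d \<Longrightarrow> subexp (\<lambda>a. c a - d a)"
  using subexp_add[OF _ subexp_uminus, of c d] by simp

text \<open>The factor \<open>a\<close> is absorbed by passing from \<open>r\<close> to the larger radius \<open>s = (1 + r) / 2\<close>.\<close>

lemma subexp_times_index [intro]:
  assumes "subexp c" shows "subexp (\<lambda>a. of_nat a * c a)"
  unfolding subexp_def
proof (intro allI impI)
  fix r :: real assume r: "0 < r" "r < 1"
  define s where "s = (1 + r) / 2"
  have s: "0 < s" "s < 1" "r < s" using r by (auto simp: s_def)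
  have "(\<lambda>n. of_nat n * (r / s) ^ n) \<longlonglongrightarrow> 0"
    using r s by (intro powser_times_n_limit_0) auto
  then have "Bseq (\<lambda>n. of_nat n * (r / s) ^ n)"
    by (intro convergent_imp_Bseq convergentI)
  then obtain K where K: "K > 0" "\<And>n. norm (of_nat n * (r / s) ^ n) \<le> K"
    by (auto simp: Bseq_def)
  have "summable (\<lambda>a. K * (norm (c a) * s ^ a))"
    using assms s by (intro summable_mult) (auto simp: subexp_def)
  then show "summable (\<lambda>a. norm (of_nat a * c a) * r ^ a)"
  proof (rule summable_comparison_test'[where N = 0])
    fix a
    have "norm (of_nat a * c a) * r ^ a = (of_nat a * (r / s) ^ a) * (norm (c a) * s ^ a)"
      using s by (simp add: norm_mult power_divide)
    also have "\<dots> \<le> K * (norm (c a) * s ^ a)"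
      using K(2)[of a] s r by (intro mult_right_mono) auto
    finally show "norm (norm (of_nat a * c a) * r ^ a) \<le> K * (norm (c a) * s ^ a)"
      using r by simp
  qed
qed

lemma summable_lambert:
  assumes "subexp c" "norm q < 1"
  shows "summable (\<lambda>a. norm (c a * lam q a))"
proof -
  define r where "r = (1 + norm q) / 2"
  have r: "0 < r" "r < 1" "norm q \<le> r" using assms(2) norm_ge_zero[of q] by (auto simp: r_def simp del: norm_ge_zero)
  have "summable (\<lambda>a. norm (c a) * r ^ a / (1 - norm q))"
    using assms(1) r by (intro summable_divide) (auto simp: subexp_def)
  then show ?thesis
  proof (rule summable_comparison_test'[where N = 0])
    fix a :: nat
    have "norm (c a) * norm (lam q a) \<le> norm (c a) * (norm q ^ a / (1 - norm q))"
      by (intro mult_left_mono norm_lam_le assms) auto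
    also have "\<dots> \<le> norm (c a) * (r ^ a / (1 - norm q))"
      using assms r by (intro mult_left_mono divide_right_mono power_mono) auto
    finally show "norm (norm (c a * lam q a)) \<le> norm (c a) * r ^ a / (1 - norm q)"
      by (simp add: norm_mult)
  qed
qed

lemma summable_lambert2:
  assumes "subexp c" "norm q < 1"
  shows "summable (\<lambda>a. norm (c a * lam2 q a))"
proof -
  define r where "r = (1 + norm q) / 2"
  have r: "0 < r" "r < 1" "norm q \<le> r" using assms(2) norm_ge_zero[of q] by (auto simp: r_def simp del: norm_ge_zero)
  have "summable (\<lambda>a. norm (c a) * r ^ a / (1 - norm q)\<^sup>2)"
    using assms(1) r by (intro summable_divide) (auto simp: subexp_def)
  then show ?thesis
  proof (rule summable_comparison_test'[where N = 0])
    fix a :: nat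
    have "norm (c a) * norm (lam2 q a) \<le> norm (c a) * (norm q ^ a / (1 - norm q)\<^sup>2)"
      by (intro mult_left_mono norm_lam2_le assms) auto
    also have "\<dots> \<le> norm (c a) * (r ^ a / (1 - norm q)\<^sup>2)"
      using assms r by (intro mult_left_mono divide_right_mono power_mono) auto
    finally show "norm (norm (c a * lam2 q a)) \<le> norm (c a) * r ^ a / (1 - norm q)\<^sup>2"
      by (simp add: norm_mult)
  qed
qed

lemma lambert_sums:
  assumes "subexp c" "norm q < 1" shows "(\<lambda>a. c a * lam q a) sums lambert c q"
  unfolding lambert_def
  by (intro summable_sums summable_norm_cancel[OF summable_lambert] assms)

lemma lambert2_sums:
  assumes "subexp c" "norm q < 1" shows "(\<lambda>a. c a * lam2 q a) sums lambert2 c q"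
  unfolding lambert2_def
  by (intro summable_sums summable_norm_cancel[OF summable_lambert2] assms)

lemma lambert_at_0 [simp]: "lambert c 0 = 0"
proof -
  have "lam 0 a = 0" for a by (cases "a = 0") (auto simp: lam_def)
  then show ?thesis by (simp add: lambert_def)
qed

lemma lambert_add:
  assumes "norm q < 1" "subexp c" "subexp d"
  shows "lambert (\<lambda>a. c a + d a) q = lambert c q + lambert d q"
  using sums_add[OF lambert_sums lambert_sums, OF assms(2,1) assms(3,1)]
    lambert_sums[OF subexp_add[OF assms(2,3)] assms(1)]
  by (auto simp: algebra_simps intro: sums_unique2)

lemma lambert_cmult:
  assumes "norm q < 1" "subexp c"
  shows "lambert (\<lambda>a. k * c a) q = k * lambert c q"
  using sums_mult[OF lambert_sums, OF assms(2,1), of k]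
    lambert_sums[OF subexp_cmult[OF assms(2), of k] assms(1)]
  by (auto simp: algebra_simps intro: sums_unique2)

lemma lambert_diff:
  assumes "norm q < 1" "subexp c" "subexp d"
  shows "lambert (\<lambda>a. c a - d a) q = lambert c q - lambert d q"
  using lambert_add[OF assms(1,2) subexp_cmult[OF assms(3), of "-1"]] lambert_cmult[OF assms(1,3), of "-1"]
  by simp

lemma lambert2_add:
  assumes "norm q < 1" "subexp c" "subexp d"
  shows "lambert2 (\<lambda>a. c a + d a) q = lambert2 c q + lambert2 d q"
  using sums_add[OF lambert2_sums lambert2_sums, OF assms(2,1) assms(3,1)]
    lambert2_sums[OF subexp_add[OF assms(2,3)] assms(1)]
  by (auto simp: algebra_simps intro: sums_unique2)

lemma lambert2_cmult:
  assumes "norm q < 1" "subexp c"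
  shows "lambert2 (\<lambda>a. k * c a) q = k * lambert2 c q"
  using sums_mult[OF lambert2_sums, OF assms(2,1), of k]
    lambert2_sums[OF subexp_cmult[OF assms(2), of k] assms(1)]
  by (auto simp: algebra_simps intro: sums_unique2)

lemma has_sum_lambert:
  assumes "subexp c" "norm q < 1"
  shows "((\<lambda>a. c a * lam q a) has_sum lambert c q) {1..}"
proof -
  have "((\<lambda>a. c a * lam q a) has_sum lambert c q) UNIV"
    unfolding lambert_def
    by (intro norm_summable_imp_has_sum summable_lambert assms summable_sums
         summable_norm_cancel[OF summable_lambert])
  then show ?thesis
    by (subst has_sum_cong_neutral[where T = UNIV and g = "\<lambda>a. c a * lam q a"]) (auto simp: Suc_le_eq)
qed

lemma infsum_lambert:
  assumes "subexp c" "norm q < 1"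
  shows "infsum (\<lambda>a. c a * lam q a) {1..} = lambert c q"
  using has_sum_lambert[OF assms] by (rule infsumI)

lemma infsum_lam_squared:
  assumes q: "norm q < 1" and c: "subexp c"
  shows "infsum (\<lambda>a. c a * (lam q a)\<^sup>2) {1..} = lambert2 c q - lambert c q"
proof (rule infsumI)
  have s: "summable (\<lambda>a. norm (c a * (lam q a)\<^sup>2))"
  proof (rule summable_comparison_test'[where N = 0])
    show "summable (\<lambda>a. norm (c a * lam2 q a) + norm (c a * lam q a))"
      by (intro summable_add summable_lambert summable_lambert2 q c)
    fix a
    have "c a * (lam q a)\<^sup>2 = c a * lam2 q a - c a * lam q a"
      by (simp add: lam2_eq[OF q] algebra_simps)
    then show "norm (norm (c a * (lam q a)\<^sup>2)) \<le> norm (c a * lam2 q a) + norm (c a * lam q a)"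
      using norm_triangle_ineq4 by simp
  qed
  have "(\<lambda>a. c a * lam2 q a - c a * lam q a) sums (lambert2 c q - lambert c q)"
    by (intro sums_diff lambert_sums lambert2_sums q c)
  then have "(\<lambda>a. c a * (lam q a)\<^sup>2) sums (lambert2 c q - lambert c q)"
    by (simp add: lam2_eq[OF q] algebra_simps)
  then have "((\<lambda>a. c a * (lam q a)\<^sup>2) has_sum (lambert2 c q - lambert c q)) UNIV"
    by (rule norm_summable_imp_has_sum[OF s])
  then show "((\<lambda>a. c a * (lam q a)\<^sup>2) has_sum (lambert2 c q - lambert c q)) {1..}"
    by (subst has_sum_cong_neutral[where T = UNIV and g = "\<lambda>a. c a * (lam q a)\<^sup>2"]) (auto simp: Suc_le_eq)
qed

text \<open>The operator \<open>q d/dq\<close> sends \<open>lam q a\<close> to \<open>a * lam2 q a\<close>. The derivative itself is obtained so that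
the statement also yields differentiability at \<open>q = 0\<close>.\<close>

lemma has_field_derivative_lambert:
  assumes c: "subexp c" and q: "norm q < 1"
  obtains D where "(lambert c has_field_derivative D) (at q)" "q * D = lambert2 (\<lambda>a. of_nat a * c a) q"
proof -
  define f where "f = (\<lambda>n x. c n * lam x n)"
  define f' where "f' = (\<lambda>n x. c n * (of_nat n * x ^ (n - 1) / (1 - x ^ n)\<^sup>2))"
  have "\<exists>g g'. \<forall>x\<in>ball 0 1. ((\<lambda>n. f n x) sums g x) \<and> ((\<lambda>n. f' n x) sums g' x)
    \<and> (g has_field_derivative g' x) (at x)"
  proof (rule series_and_derivative_comparison_complex)
    fix n and x :: complex assume x: "x \<in> ball 0 1"
    show "(f n has_field_derivative f' n x) (at x)"
    proof (cases "n = 0")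
      case True
      then show ?thesis by (simp add: f_def f'_def)
    next
      case False
      then have nz: "1 - x ^ n \<noteq> 0" using x by (intro one_minus_power_nonzero) auto
      have "((\<lambda>x. c n * (x ^ n / (1 - x ^ n))) has_field_derivative
        c n * ((of_nat n * x ^ (n - 1) * (1 - x ^ n) - x ^ n * (- (of_nat n * x ^ (n - 1)))) / ((1 - x ^ n) * (1 - x ^ n)))) (at x)"
        by (rule derivative_eq_intros refl nz | simp add: mult_ac)+
      moreover have "of_nat n * x ^ (n - 1) * (1 - x ^ n) - x ^ n * (- (of_nat n * x ^ (n - 1))) = of_nat n * x ^ (n - 1)"
        by (simp add: algebra_simps)
      ultimately show ?thesis
        by (simp add: f_def f'_def lam_def[abs_def] power2_eq_square)
    qed
  next
    fix x :: complex assume "x \<in> ball 0 1"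
    then have x: "norm x < 1" by simp
    define R where "R = (1 + norm x) / 2"
    have R: "0 < R" "R < 1" "norm x < R" using x norm_ge_zero[of x] by (auto simp: R_def simp del: norm_ge_zero)
    define h where "h = (\<lambda>n. norm (c n) * R ^ n / (1 - R))"
    have hs: "summable h" unfolding h_def using c R by (intro summable_divide) (auto simp: subexp_def)
    have h0: "h n \<ge> 0" for n using R by (simp add: h_def)
    have bd: "norm (f n y) \<le> h n" if y: "y \<in> ball x (R - norm x)" for n y
    proof -
      have "norm y \<le> norm x + dist x y" by (metis add.commute dist_commute dist_norm norm_triangle_sub)
      then have yR: "norm y < R" using y by simp
      have "norm (lam y n) \<le> norm y ^ n / (1 - norm y)" using yR R by (intro norm_lam_le) auto
      also have "\<dots> \<le> R ^ n / (1 - R)" using yR R by (intro frac_le power_mono) auto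
      finally show ?thesis unfolding f_def h_def norm_mult
        using mult_left_mono[of "norm (lam y n)" "R ^ n / (1 - R)" "norm (c n)"] by simp
    qed
    show "\<exists>d h. 0 < d \<and> summable h \<and> range h \<subseteq> \<real>\<^sub>\<ge>\<^sub>0 \<and>
      (\<forall>\<^sub>F n in sequentially. \<forall>y\<in>ball x d \<inter> ball 0 1. cmod (f n y) \<le> cmod (h n))"
      using R hs h0 bd
      by (intro exI[of _ "R - norm x"] exI[of _ "\<lambda>n. complex_of_real (h n)"])
         (auto simp: summable_of_real intro!: always_eventually)
  qed auto
  then obtain g g' where g: "\<And>x. norm x < 1 \<Longrightarrow> (\<lambda>n. f n x) sums g x"
    "\<And>x. norm x < 1 \<Longrightarrow> (\<lambda>n. f' n x) sums g' x"
    "\<And>x. norm x < 1 \<Longrightarrow> (g has_field_derivative g' x) (at x)" by force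
  have "(lambert c has_field_derivative g' q) (at q)"
  proof (rule has_field_derivative_transform_within[OF g(3)[OF q]])
    show "0 < 1 - norm q" using q by simp
    fix x assume "dist x q < 1 - norm q"
    then have "norm x < 1"
      by (smt (verit) dist_norm norm_triangle_sub)
    then show "g x = lambert c x"
      using g(1)[of x] lambert_sums[OF c, of x] unfolding f_def by (blast intro: sums_unique2)
  qed simp
  moreover have "q * g' q = lambert2 (\<lambda>a. of_nat a * c a) q"
  proof (rule sums_unique2)
    show "(\<lambda>n. q * f' n q) sums (q * g' q)" by (intro sums_mult g q)
    have "q * f' n q = of_nat n * c n * lam2 q n" for n
      by (cases n) (simp_all add: f'_def lam2_def)
    then show "(\<lambda>n. q * f' n q) sums lambert2 (\<lambda>a. of_nat a * c a) q"
      using lambert2_sums[OF subexp_times_index[OF c] q] by simp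
  qed
  ultimately show ?thesis using that by blast
qed

section \<open>Products of two Lambert series\<close>

definition bounded2 :: "(nat \<Rightarrow> nat \<Rightarrow> complex) \<Rightarrow> bool" where
  "bounded2 g \<longleftrightarrow> (\<exists>C. \<forall>a b. norm (g a b) \<le> C)"

definition double_lambert :: "complex \<Rightarrow> (nat \<Rightarrow> nat \<Rightarrow> complex) \<Rightarrow> complex" where
  "double_lambert q g = infsum (\<lambda>(a, b). g a b * (lam q a * lam q b)) ({1..} \<times> {1..})"

lemma bounded2_add [intro]: "bounded2 g \<Longrightarrow> bounded2 h \<Longrightarrow> bounded2 (\<lambda>a b. g a b + h a b)"
  unfolding bounded2_def by (meson add_mono norm_triangle_le)

lemma bounded2_uminus [intro]: "bounded2 g \<Longrightarrow> bounded2 (\<lambda>a b. - g a b)"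
  by (simp add: bounded2_def)

lemma bounded2_if:
  assumes "bounded2 g" shows "bounded2 (\<lambda>a b. if P a b then g a b else 0)"
proof -
  obtain C where C: "\<And>a b. norm (g a b) \<le> C" using assms by (auto simp: bounded2_def)
  have C0: "0 \<le> C" using C[of 0 0] norm_ge_zero order_trans by blast
  show ?thesis unfolding bounded2_def using C C0 by (intro exI[of _ C]) auto
qed

lemma bounded2_int:
  fixes E :: "int \<Rightarrow> int \<Rightarrow> complex"
  assumes "\<And>a b. norm (E a b) \<le> C"
  shows "bounded2 (\<lambda>a b. E (i a b) (j a b))"
  using assms by (auto simp: bounded2_def)

lemma geometric_pairs_summable:
  fixes q :: complex
  assumes "norm q < 1"
  shows "(\<lambda>(a, b). norm q ^ a * norm q ^ b) summable_on (UNIV :: nat set) \<times> (UNIV :: nat set)"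
proof (rule summable_on_SigmaI)
  have "summable (\<lambda>a. norm q ^ a)"
    using assms by (intro summable_geometric) auto
  then have geo: "(\<lambda>a. norm q ^ a) summable_on UNIV"
    by (intro norm_summable_imp_summable_on) auto
  fix a :: nat
  show "((\<lambda>b. case (a, b) of (a, b) \<Rightarrow> norm q ^ a * norm q ^ b) has_sum
    (norm q ^ a * infsum (\<lambda>b. norm q ^ b) UNIV)) UNIV"
    using has_sum_cmult_right[OF has_sum_infsum[OF geo]] by simp
  show "(\<lambda>a. norm q ^ a * infsum (\<lambda>b. norm q ^ b) UNIV) summable_on UNIV"
    by (rule summable_on_cmult_left[OF geo])
qed auto

text \<open>All double series below converge absolutely because they are dominated by a geometric one.\<close>

lemma dominated_pairs_summable:
  fixes q :: complex and h :: "nat \<Rightarrow> nat \<Rightarrow> complex"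
  assumes q: "norm q < 1"
    and h: "\<And>a b. a > 0 \<Longrightarrow> b > 0 \<Longrightarrow> norm (h a b) \<le> C * (norm q ^ a * norm q ^ b)"
  shows "(\<lambda>(a, b). h a b) summable_on {1..} \<times> {1..}"
proof -
  have "(\<lambda>x. C * (case x of (a, b) \<Rightarrow> norm q ^ a * norm q ^ b)) summable_on {1::nat..} \<times> {1::nat..}"
    by (rule summable_on_subset_banach[OF summable_on_cmult_right[OF geometric_pairs_summable[OF q]]]) auto
  then have "(\<lambda>x. norm (case x of (a, b) \<Rightarrow> h a b)) summable_on {1::nat..} \<times> {1::nat..}"
    by (rule summable_on_comparison_test) (use h in auto)
  then show ?thesis by (rule abs_summable_summable)
qed

lemma summable_dsum:
  assumes q: "norm q < 1" and g: "bounded2 g"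
  shows "(\<lambda>(a, b). g a b * (lam q a * lam q b)) summable_on {1..} \<times> {1..}"
proof -
  obtain C where C: "\<And>a b. norm (g a b) \<le> C" using g by (auto simp: bounded2_def)
  have C0: "0 \<le> C" using C[of 0 0] norm_ge_zero order_trans by blast
  define K where "K = 1 / (1 - norm q)"
  show ?thesis
  proof (rule dominated_pairs_summable[OF q, where C = "C * K^2"])
    fix a b :: nat
    have "norm (g a b * (lam q a * lam q b)) \<le> C * ((norm q ^ a * K) * (norm q ^ b * K))"
      unfolding norm_mult
      using norm_lam_le[OF q] q C C0
      by (intro mult_mono) (auto simp: K_def)
    then show "norm (g a b * (lam q a * lam q b)) \<le> C * K^2 * (norm q ^ a * norm q ^ b)"
      by (simp add: power2_eq_square mult_ac)
  qed
qed

lemma lambert_mult: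
  assumes q: "norm q < 1" and c: "\<And>a. norm (c a) \<le> C" and d: "\<And>a. norm (d a) \<le> C'"
  shows "lambert c q * lambert d q = double_lambert q (\<lambda>a b. c a * d b)"
proof -
  have "bounded2 (\<lambda>a b. c a * d b)"
    unfolding bounded2_def norm_mult
    using c d by (intro exI[of _ "C * C'"] allI mult_mono) (auto intro: order_trans[OF norm_ge_zero])
  note s = summable_dsum[OF q this]
  have "double_lambert q (\<lambda>a b. c a * d b) = infsum (\<lambda>a. infsum (\<lambda>b. c a * d b * (lam q a * lam q b)) {1..}) {1..}"
    unfolding double_lambert_def by (rule infsum_Sigma'_banach[symmetric, OF s])
  also have "\<dots> = infsum (\<lambda>a. (c a * lam q a) * infsum (\<lambda>b. d b * lam q b) {1..}) {1..}"
    by (subst infsum_cmult_right'[symmetric]) (simp add: mult_ac)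
  also have "\<dots> = lambert c q * lambert d q"
    by (subst infsum_cmult_left') (use infsum_lambert[OF subexp_bounded[OF c] q] infsum_lambert[OF subexp_bounded[OF d] q] in auto)
  finally show ?thesis by simp
qed

lemma double_lambert_cong:
  assumes "\<And>a b. a > 0 \<Longrightarrow> b > 0 \<Longrightarrow> g a b = h a b"
  shows "double_lambert q g = double_lambert q h"
  unfolding double_lambert_def using assms by (intro infsum_cong) auto

lemma double_lambert_swap: "double_lambert q g = double_lambert q (\<lambda>a b. g b a)"
  unfolding double_lambert_def
  by (rule infsum_reindex_bij_witness[where i = prod.swap and j = prod.swap]) (auto simp: mult_ac)

lemma double_lambert_add:
  assumes "norm q < 1" "bounded2 g" "bounded2 h"
  shows "double_lambert q (\<lambda>a b. g a b + h a b) = double_lambert q g + double_lambert q h"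
  unfolding double_lambert_def
  by (subst infsum_add[OF summable_dsum[OF assms(1,2)] summable_dsum[OF assms(1,3)], symmetric])
     (auto intro!: infsum_cong simp: algebra_simps)

lemma double_lambert_uminus: "double_lambert q (\<lambda>a b. - g a b) = - double_lambert q g"
  unfolding double_lambert_def by (subst infsum_uminus[symmetric]) (auto intro!: infsum_cong)

lemma double_lambert_diff:
  assumes "norm q < 1" "bounded2 g" "bounded2 h"
  shows "double_lambert q (\<lambda>a b. g a b - h a b) = double_lambert q g - double_lambert q h"
  using double_lambert_add[OF assms(1,2) bounded2_uminus[OF assms(3)]] by (simp add: double_lambert_uminus)

lemma double_lambert_diagonal:
  assumes q: "norm q < 1"
  shows "double_lambert q (\<lambda>a b. if a = b then h a else 0) = infsum (\<lambda>c. h c * (lam q c)\<^sup>2) {1..}"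
proof -
  have "double_lambert q (\<lambda>a b. if a = b then h a else 0) = infsum (\<lambda>(a, b). h a * (lam q a)\<^sup>2) {(a, b). 1 \<le> a \<and> a = b}"
    unfolding double_lambert_def by (rule infsum_cong_neutral) (auto simp: power2_eq_square split: if_splits)
  also have "\<dots> = infsum (\<lambda>c. h c * (lam q c)\<^sup>2) {1..}"
    by (rule infsum_reindex_bij_witness[where j = fst and i = "\<lambda>c. (c, c)"]) auto
  finally show ?thesis .
qed

text \<open>After \<open>lam_mult\<close> is applied to every term, substituting \<open>c = a + b\<close> for one of the two indices turns the
summands with two factors back into double series; the remaining summand depends on \<open>a + b\<close> only and
collapses to a single series.\<close>

lemma double_lambert_split:
  assumes q: "norm q < 1" and g: "bounded2 g"
  shows "double_lambert q g = infsum (\<lambda>c. (\<Sum>a=1..<c. g a (c - a)) * lam q c) {1..}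
     + double_lambert q (\<lambda>a b. if b < a then g (a - b) b else 0)
     + double_lambert q (\<lambda>a b. if a < b then g a (b - a) else 0)"
proof -
  obtain C where C: "\<And>a b. norm (g a b) \<le> C" using g by (auto simp: bounded2_def)
  have C0: "0 \<le> C" using C[of 0 0] norm_ge_zero order_trans by blast
  define K where "K = 1 / (1 - norm q)"
  have K0: "K \<ge> 0" using q by (simp add: K_def)
  let ?P = "{1::nat..} \<times> {1::nat..}"
  let ?f0 = "\<lambda>(a, b). g a b * lam q (a + b)"
  let ?f1 = "\<lambda>(a, b). g a b * (lam q (a + b) * lam q b)"
  let ?f2 = "\<lambda>(a, b). g a b * (lam q (a + b) * lam q a)"
  have L: "norm (lam q a) \<le> norm q ^ a * K" for a
    using norm_lam_le[OF q, of a] by (simp add: K_def)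
  have L1: "norm (lam q a) \<le> K" for a
  proof -
    have "norm q ^ a * K \<le> 1 * K"
      using q K0 by (intro mult_right_mono power_le_one) auto
    then show ?thesis using L[of a] by simp
  qed
  have s0: "?f0 summable_on ?P"
  proof (rule dominated_pairs_summable[OF q, where C = "C * K"])
    fix a b :: nat
    have "norm (g a b * lam q (a + b)) \<le> C * (norm q ^ (a + b) * K)"
      unfolding norm_mult using L C C0 by (intro mult_mono) auto
    then show "norm (g a b * lam q (a + b)) \<le> C * K * (norm q ^ a * norm q ^ b)"
      by (simp add: power_add mult_ac)
  qed
  have aux: "norm (g a b * (lam q (a + b) * lam q c)) \<le> C * K^2 * (norm q ^ a * norm q ^ b)" for a b c
  proof -
    have "norm (g a b * (lam q (a + b) * lam q c)) \<le> C * ((norm q ^ (a + b) * K) * K)"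
      unfolding norm_mult using L L1 C C0 K0 by (intro mult_mono) auto
    then show ?thesis by (simp add: power_add mult_ac power2_eq_square)
  qed
  have s1: "?f1 summable_on ?P" and s2: "?f2 summable_on ?P"
    by (rule dominated_pairs_summable[OF q, where C = "C * K^2"], rule aux)+
  have "double_lambert q g = infsum (\<lambda>x. ?f0 x + (?f1 x + ?f2 x)) ?P"
    unfolding double_lambert_def
  proof (rule infsum_cong)
    fix x :: "nat \<times> nat" assume "x \<in> ?P"
    then obtain a b where x: "x = (a, b)" and "a > 0" "b > 0" by auto
    then have "lam q a * lam q b = lam q (a + b) * (1 + lam q a + lam q b)"
      by (intro lam_mult q) auto
    then show "(case x of (a, b) \<Rightarrow> g a b * (lam q a * lam q b)) = ?f0 x + (?f1 x + ?f2 x)"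
      unfolding x by (simp only: case_prod_conv) (simp add: algebra_simps)
  qed
  also have "\<dots> = infsum ?f0 ?P + (infsum ?f1 ?P + infsum ?f2 ?P)"
    using s0 s1 s2 by (subst infsum_add; simp add: summable_on_add infsum_add)
  \<comment> \<open>The term without a second factor depends on \<open>c = a + b\<close>; the index \<open>a\<close> runs below \<open>c\<close>.\<close>
  also have "infsum ?f0 ?P = infsum (\<lambda>(c, a). g a (c - a) * lam q c) (Sigma {1..} (\<lambda>c. {1..<c}))"
    by (rule infsum_reindex_bij_witness[where j = "\<lambda>(a, b). (a + b, a)" and i = "\<lambda>(c, a). (a, c - a)"]) auto
  also have "\<dots> = infsum (\<lambda>c. infsum (\<lambda>a. g a (c - a) * lam q c) {1..<c}) {1..}"
  proof (rule infsum_Sigma'_banach[symmetric])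
    show "(\<lambda>(c, a). g a (c - a) * lam q c) summable_on (Sigma {1..} (\<lambda>c. {1..<c}))"
      using s0
      by (subst summable_on_reindex_bij_witness[where i = "\<lambda>(a, b). (a + b, a)" and j = "\<lambda>(c, a). (a, c - a)"
        and T = ?P and h = ?f0]) auto
  qed
  also have "\<dots> = infsum (\<lambda>c. (\<Sum>a=1..<c. g a (c - a)) * lam q c) {1..}"
    by (intro infsum_cong) (simp add: sum_distrib_right)
  also have "infsum ?f1 ?P = infsum (\<lambda>(a, b). g (a - b) b * (lam q a * lam q b)) {(a, b). 1 \<le> b \<and> b < a}"
    by (rule infsum_reindex_bij_witness[where j = "\<lambda>(a, b). (a + b, b)" and i = "\<lambda>(c, b). (c - b, b)"]) auto
  also have "\<dots> = double_lambert q (\<lambda>a b. if b < a then g (a - b) b else 0)"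
    unfolding double_lambert_def by (rule infsum_cong_neutral) (auto split: if_splits)
  also have "infsum ?f2 ?P = infsum (\<lambda>(a, b). g a (b - a) * (lam q a * lam q b)) {(a, b). 1 \<le> a \<and> a < b}"
    by (rule infsum_reindex_bij_witness[where j = "\<lambda>(a, b). (a, a + b)" and i = "\<lambda>(a, c). (a, c - a)"]) auto
  also have "\<dots> = double_lambert q (\<lambda>a b. if a < b then g a (b - a) else 0)"
    unfolding double_lambert_def by (rule infsum_cong_neutral) (auto split: if_splits)
  finally show ?thesis by simp
qed

text \<open>The double series identity behind all elliptic identities below. Applied to the three subtracted terms,
\<open>double_lambert_split\<close> produces six sums over \<open>a < b\<close> or \<open>b < a\<close>. By evenness of \<open>E\<close> they fit together to the
sum of \<open>h a b\<close> over all \<open>a \<noteq> b\<close>, and \<open>h\<close> is the positive part with \<open>a\<close> and \<open>b\<close> interchanged. Only the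
diagonal of \<open>h\<close> and the single series from the splitting survive.\<close>

lemma triple_identity_coefficients:
  fixes E :: "int \<Rightarrow> int \<Rightarrow> complex"
  assumes q: "norm q < 1" and bdd: "\<And>a b. norm (E a b) \<le> C" and even: "\<And>a b. E (- a) (- b) = E a b"
  shows "double_lambert q (\<lambda>a b. (E (int a) (int b) + E (int b) (int b - int a) + E (int a - int b) (int a))
         - (E (int a) (- int b) + E (int b) (int a + int b) + E (int a + int b) (int a)))
     = infsum (\<lambda>c. (E (int c) (int c) + E (int c) 0 + E 0 (int c)) * (lam q c)\<^sup>2) {1..}
       - infsum (\<lambda>c. (\<Sum>a=1..<c. E (int a) (int a - int c) + E (int c - int a) (int c) + E (int c) (int a)) * lam q c) {1..}"
proof -
  note B = bounded2_int[OF bdd]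
  define h where "h = (\<lambda>a b. E (int b) (int a) + E (int a) (int a - int b) + E (int b - int a) (int b))"
  have Bh: "bounded2 h" unfolding h_def by (intro bounded2_add B)
  have pos: "double_lambert q (\<lambda>a b. E (int a) (int b) + E (int b) (int b - int a) + E (int a - int b) (int a)) = double_lambert q h"
    unfolding h_def by (rule double_lambert_swap)
  let ?n = "\<lambda>a b. E (int a) (- int b) + E (int b) (int a + int b) + E (int a + int b) (int a)"
  have Bn: "bounded2 ?n" by (intro bounded2_add B)
  have ge: "b < a \<Longrightarrow> ?n (a - b) b = h a b" for a b
    using even[of "int a - int b" "- int b"] by (simp add: h_def of_nat_diff)
  have le: "a < b \<Longrightarrow> ?n a (b - a) = h a b" for a b
    by (simp add: h_def of_nat_diff)
  have "double_lambert q ?n = infsum (\<lambda>c. (\<Sum>a=1..<c. ?n a (c - a)) * lam q c) {1..}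
     + (double_lambert q (\<lambda>a b. if b < a then ?n (a - b) b else 0)
     + double_lambert q (\<lambda>a b. if a < b then ?n a (b - a) else 0))"
    using double_lambert_split[OF q Bn] by simp
  also have "(\<lambda>a b. if b < a then ?n (a - b) b else 0) = (\<lambda>a b. if b < a then h a b else 0)"
    using ge by (intro ext) auto
  also have "(\<lambda>a b. if a < b then ?n a (b - a) else 0) = (\<lambda>a b. if a < b then h a b else 0)"
    using le by (intro ext) auto
  also have "double_lambert q (\<lambda>a b. if b < a then h a b else 0) + double_lambert q (\<lambda>a b. if a < b then h a b else 0)
      = double_lambert q (\<lambda>a b. h a b - (if a = b then h a b else 0))"
    by (subst double_lambert_add[OF q, symmetric])
       (auto intro!: bounded2_if Bh double_lambert_cong)
  also have "\<dots> = double_lambert q h - double_lambert q (\<lambda>a b. if a = b then h a b else 0)"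
    by (intro double_lambert_diff q Bh bounded2_if)
  also have "(\<lambda>a b. if a = b then h a b else 0) = (\<lambda>a b. if a = b then h a a else 0)"
    by (intro ext) auto
  also have "double_lambert q \<dots> = infsum (\<lambda>c. h c c * (lam q c)\<^sup>2) {1..}"
    by (rule double_lambert_diagonal[OF q])
  finally have neg: "double_lambert q ?n = infsum (\<lambda>c. (\<Sum>a=1..<c. ?n a (c - a)) * lam q c) {1..} +
      (double_lambert q h - infsum (\<lambda>c. h c c * (lam q c)\<^sup>2) {1..})" .
  have inner: "(\<Sum>a=1..<c. ?n a (c - a)) = (\<Sum>a=1..<c. E (int a) (int a - int c) + E (int c - int a) (int c) + E (int c) (int a))" for c
    by (intro sum.cong) (auto simp: of_nat_diff)
  show ?thesis
    by (subst double_lambert_diff[OF q]) (auto intro!: bounded2_add B simp: pos neg inner h_def)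
qed

section \<open>The logarithmic derivative of the theta function on the unit circle\<close>

text \<open>The coefficients \<open>X^a - X^(-a)\<close> and their images under \<open>X d/dX\<close>: each application multiplies by \<open>a\<close> and
changes the relative sign. The coefficients \<open>cowave\<close> have the opposite parity; they appear after a
differentiation with respect to \<open>q\<close>.\<close>

definition wave :: "nat \<Rightarrow> complex \<Rightarrow> nat \<Rightarrow> complex" where
  "wave j X a = of_nat a ^ j * (X ^ a - (- 1) ^ j * inverse X ^ a)"

definition cowave :: "nat \<Rightarrow> complex \<Rightarrow> nat \<Rightarrow> complex" where
  "cowave j X a = of_nat a ^ j * (X ^ a + (- 1) ^ j * inverse X ^ a)"

lemma subexp_pow: "norm X = 1 \<Longrightarrow> subexp (\<lambda>a. of_nat a ^ j * X ^ a)"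
proof (induction j)
  case 0
  then show ?case by (auto intro!: subexp_bounded[where C = 1] simp: norm_power)
next
  case (Suc j)
  then show ?case using subexp_times_index by (auto simp: mult_ac)
qed

lemma subexp_wave: "norm X = 1 \<Longrightarrow> subexp (wave j X)"
  using subexp_diff[OF subexp_pow[of X j] subexp_cmult[OF subexp_pow[of "inverse X" j], of "(-1)^j"]]
  by (simp add: wave_def[abs_def] norm_inverse algebra_simps)

lemma subexp_cowave: "norm X = 1 \<Longrightarrow> subexp (cowave j X)"
  using subexp_add[OF subexp_pow[of X j] subexp_cmult[OF subexp_pow[of "inverse X" j], of "(-1)^j"]]
  by (simp add: cowave_def[abs_def] norm_inverse algebra_simps)

lemma index_times_wave: "of_nat a * wave j X a = cowave (Suc j) X a"
  by (simp add: wave_def cowave_def)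

lemma norm_wave_le: "norm X = 1 \<Longrightarrow> norm (wave 0 X a) \<le> 2"
  using norm_triangle_ineq4[of "X ^ a" "inverse X ^ a"]
  by (simp add: wave_def norm_power norm_inverse)

lemma bounded2_waves:
  assumes "norm U = 1" "norm V = 1"
  shows "bounded2 (\<lambda>a b. wave 0 U a * wave 0 V b)"
  unfolding bounded2_def norm_mult using norm_wave_le assms
  by (intro exI[of _ "2 * 2"] allI mult_mono) auto

text \<open>The value of \<open>\<rho>\<close> at \<open>q = 0\<close>. For \<open>X = exp (\<i> t)\<close> it is \<open>\<i> / 2 * cot (t / 2)\<close>.\<close>

definition mu :: "complex \<Rightarrow> complex" where
  "mu X = (1 + X) / (2 * (1 - X))"

lemma mu_inverse: "X \<noteq> 0 \<Longrightarrow> X \<noteq> 1 \<Longrightarrow> mu (inverse X) = - mu X"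
  unfolding mu_def by (simp add: divide_simps) algebra

text \<open>The relation between the cotangents of three angles whose sum is a multiple of \<open>\<pi>\<close>.\<close>

lemma mu_triple:
  assumes "X * Y * Z = 1" "X \<noteq> 1" "Y \<noteq> 1" "Z \<noteq> 1"
  shows "mu X * mu Y + mu Y * mu Z + mu Z * mu X = - 1 / 4"
  unfolding mu_def using assms by (simp add: divide_simps) algebra

text \<open>Stated with \<open>mu\<close> so that the inner sums of the double series identity directly produce the cross terms
of the products of \<open>\<rho>\<close>.\<close>

lemma geometric_two_sided:
  assumes W: "W \<noteq> 0" "W \<noteq> 1" and c: "c > 0"
  shows "(\<Sum>a=1..<c. p * W ^ a + p' * inverse W ^ a) =
    mu W * ((p - p') + (p' * inverse W ^ c - p * W ^ c)) - (p + p' + p * W ^ c + p' * inverse W ^ c) / 2"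
proof -
  have g: "(\<Sum>a=1..<c. V ^ a) = (V - V ^ c) / (1 - V)" if "V \<noteq> 1" for V :: complex
    using c
  proof (induction c rule: nat_induct_non_zero)
    case (Suc c)
    have "(\<Sum>a=1..<Suc c. V ^ a) = (V - V ^ c) / (1 - V) + V ^ c"
      using Suc by simp
    also have "\<dots> = (V - V ^ Suc c) / (1 - V)" using that by (simp add: field_simps)
    finally show ?case .
  qed simp
  have "inverse W \<noteq> 1" using W by simp
  note gs = g[OF W(2)] g[OF this]
  have "(\<Sum>a=1..<c. p * W ^ a + p' * inverse W ^ a) = p * ((W - W ^ c) / (1 - W))
       + p' * ((inverse W - inverse W ^ c) / (1 - inverse W))"
    by (simp add: sum.distrib sum_distrib_left[symmetric] gs del: power_inverse One_nat_def)
  also have "(W - W ^ c) / (1 - W) = mu W - 1/2 - W ^ c * (mu W + 1/2)"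
    using W by (simp add: mu_def divide_simps) algebra
  also have "(inverse W - inverse W ^ c) / (1 - inverse W) = - mu W - 1/2 - inverse W ^ c * (1/2 - mu W)"
    using W by (simp add: mu_def divide_simps) algebra
  finally show ?thesis by (simp add: algebra_simps add_divide_distrib diff_divide_distrib)
qed

definition rho :: "complex \<Rightarrow> complex \<Rightarrow> complex" where
  "rho q X = mu X + lambert (wave 0 X) q"

abbreviation cosine_series :: "nat \<Rightarrow> complex \<Rightarrow> complex \<Rightarrow> complex" where
  "cosine_series j q X \<equiv> lambert2 (cowave j X) q"

text \<open>An even function on pairs of integers: the character \<open>(a, b) \<mapsto> X^a Y^b\<close> plus its inverse.\<close>

definition torus_char :: "complex \<Rightarrow> complex \<Rightarrow> int \<Rightarrow> int \<Rightarrow> complex" where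
  "torus_char X Y a b = X powi a * Y powi b + X powi (- a) * Y powi (- b)"

lemma torus_char_bound: "norm X = 1 \<Longrightarrow> norm Y = 1 \<Longrightarrow> norm (torus_char X Y a b) \<le> 2"
  unfolding torus_char_def
  using norm_triangle_ineq[of "X powi a * Y powi b" "X powi (- a) * Y powi (- b)"]
  by (simp add: norm_mult norm_power_int)

lemma torus_char_even: "torus_char X Y (- a) (- b) = torus_char X Y a b"
  by (simp add: torus_char_def)

text \<open>The double series identity for \<open>E (a, b) = X^a Y^b + X^(-a) Y^(-b)\<close>. With \<open>Z = 1 / (X Y)\<close> the six terms on
its left side group into the three products of the coefficients of \<open>\<rho>(X)\<close>, \<open>\<rho>(Y)\<close> and \<open>\<rho>(Z)\<close>, and
the inner geometric sums on its right side supply the products of a constant term with a series.\<close>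

lemma rho_triple:
  assumes q: "norm q < 1" and n: "norm X = 1" "norm Y = 1" "norm Z = 1"
    and prod: "X * Y * Z = 1" and ne: "X \<noteq> 1" "Y \<noteq> 1" "Z \<noteq> 1"
  shows "rho q X * rho q Y + rho q Y * rho q Z + rho q Z * rho q X
     = - 1 / 4 + cosine_series 0 q X + cosine_series 0 q Y + cosine_series 0 q Z"
proof -
  have nz: "X \<noteq> 0" "Y \<noteq> 0" "Z \<noteq> 0" using n by auto
  have Z: "Z = inverse (X * Y)" using prod nz by (simp add: field_simps)
  let ?L = "\<lambda>X. lambert (wave 0 X) q"
  let ?E = "torus_char X Y"
  have "?L X * ?L Y + ?L Y * ?L Z + ?L Z * ?L X =
    double_lambert q (\<lambda>a b. wave 0 X a * wave 0 Y b) + double_lambert q (\<lambda>a b. wave 0 Y a * wave 0 Z b) + double_lambert q (\<lambda>a b. wave 0 Z a * wave 0 X b)"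
    by (simp add: lambert_mult[OF q norm_wave_le norm_wave_le] n)
  also have "\<dots> = double_lambert q (\<lambda>a b. wave 0 X a * wave 0 Y b + wave 0 Y a * wave 0 Z b + wave 0 Z a * wave 0 X b)"
    by (simp add: double_lambert_add[OF q] bounded2_add bounded2_waves n)
  also have "\<dots> = double_lambert q (\<lambda>a b. (?E (int a) (int b) + ?E (int b) (int b - int a) + ?E (int a - int b) (int a))
         - (?E (int a) (- int b) + ?E (int b) (int a + int b) + ?E (int a + int b) (int a)))"
    by (intro double_lambert_cong)
       (simp add: torus_char_def wave_def Z nz power_int_add power_int_diff power_int_minus power_mult_distrib field_simps)
  also have "\<dots> = infsum (\<lambda>c. (?E (int c) (int c) + ?E (int c) 0 + ?E 0 (int c)) * (lam q c)\<^sup>2) {1..}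
       - infsum (\<lambda>c. (\<Sum>a=1..<c. ?E (int a) (int a - int c) + ?E (int c - int a) (int c) + ?E (int c) (int a)) * lam q c) {1..}"
    by (rule triple_identity_coefficients[where E = "?E", OF q torus_char_bound[OF n(1,2)] torus_char_even])
  also have "(\<lambda>c. (?E (int c) (int c) + ?E (int c) 0 + ?E 0 (int c)) * (lam q c)\<^sup>2)
     = (\<lambda>c. (cowave 0 X c + cowave 0 Y c + cowave 0 Z c) * (lam q c)\<^sup>2)"
    by (intro ext) (simp add: torus_char_def cowave_def Z nz power_int_minus power_mult_distrib field_simps)
  also have "infsum (\<lambda>c. (\<Sum>a=1..<c. ?E (int a) (int a - int c) + ?E (int c - int a) (int c) + ?E (int c) (int a)) * lam q c) {1..}
    = infsum (\<lambda>c. (mu X * wave 0 Y c + mu X * wave 0 Z c + mu Y * wave 0 Z c + mu Y * wave 0 X c + mu Z * wave 0 X c + mu Z * wave 0 Y c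
        - (cowave 0 X c + cowave 0 Y c + cowave 0 Z c)) * lam q c) {1..}"
  proof (intro infsum_cong arg_cong2[where f = "(*)"] refl)
    fix c :: nat assume "c \<in> {1..}"
    then have c: "c > 0" by simp
    have "(\<Sum>a=1..<c. ?E (int a) (int a - int c) + ?E (int c - int a) (int c) + ?E (int c) (int a))
       = (\<Sum>a=1..<c. (Y ^ c * Z ^ a + inverse Y ^ c * inverse Z ^ a) + (Z ^ c * X ^ a + inverse Z ^ c * inverse X ^ a)
           + (X ^ c * Y ^ a + inverse X ^ c * inverse Y ^ a))"
      by (intro sum.cong refl)
         (simp add: torus_char_def Z nz power_int_add power_int_diff power_int_minus power_mult_distrib field_simps)
    also have "\<dots> = (\<Sum>a=1..<c. Y ^ c * Z ^ a + inverse Y ^ c * inverse Z ^ a)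
      + (\<Sum>a=1..<c. Z ^ c * X ^ a + inverse Z ^ c * inverse X ^ a)
      + (\<Sum>a=1..<c. X ^ c * Y ^ a + inverse X ^ c * inverse Y ^ a)"
      by (simp only: sum.distrib)
    also have "\<dots> = mu X * wave 0 Y c + mu X * wave 0 Z c + mu Y * wave 0 Z c + mu Y * wave 0 X c + mu Z * wave 0 X c + mu Z * wave 0 Y c
        - (cowave 0 X c + cowave 0 Y c + cowave 0 Z c)"
    proof -
      have r: "Y ^ c * Z ^ c = inverse X ^ c" "inverse Y ^ c * inverse Z ^ c = X ^ c"
        "Z ^ c * X ^ c = inverse Y ^ c" "inverse Z ^ c * inverse X ^ c = Y ^ c"
        "X ^ c * Y ^ c = inverse Z ^ c" "inverse X ^ c * inverse Y ^ c = Z ^ c"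
        using nz by (simp_all add: Z power_mult_distrib field_simps)
      show ?thesis
        unfolding geometric_two_sided[OF nz(1) ne(1) c] geometric_two_sided[OF nz(2) ne(2) c]
          geometric_two_sided[OF nz(3) ne(3) c] r
        by (simp add: wave_def cowave_def field_simps)
    qed
    finally show "(\<Sum>a=1..<c. ?E (int a) (int a - int c) + ?E (int c - int a) (int c) + ?E (int c) (int a)) = \<dots>" .
  qed
  also have "infsum (\<lambda>c. (cowave 0 X c + cowave 0 Y c + cowave 0 Z c) * (lam q c)\<^sup>2) {1..} -
     infsum (\<lambda>c. (mu X * wave 0 Y c + mu X * wave 0 Z c + mu Y * wave 0 Z c + mu Y * wave 0 X c + mu Z * wave 0 X c + mu Z * wave 0 Y c
        - (cowave 0 X c + cowave 0 Y c + cowave 0 Z c)) * lam q c) {1..} =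
     cosine_series 0 q X + cosine_series 0 q Y + cosine_series 0 q Z - (mu X * ?L Y + mu X * ?L Z + mu Y * ?L Z + mu Y * ?L X + mu Z * ?L X + mu Z * ?L Y)"
    using subexp_wave[OF n(1), of 0] subexp_wave[OF n(2), of 0] subexp_wave[OF n(3), of 0]
      subexp_cowave[OF n(1), of 0] subexp_cowave[OF n(2), of 0] subexp_cowave[OF n(3), of 0]
    by (simp add: infsum_lam_squared[OF q] infsum_lambert[OF _ q] subexp_add subexp_diff subexp_cmult
        lambert_add[OF q] lambert_diff[OF q] lambert_cmult[OF q] lambert2_add[OF q] del: One_nat_def)
  finally have L: "?L X * ?L Y + ?L Y * ?L Z + ?L Z * ?L X = cosine_series 0 q X + cosine_series 0 q Y + cosine_series 0 q Z
    - (mu X * ?L Y + mu X * ?L Z + mu Y * ?L Z + mu Y * ?L X + mu Z * ?L X + mu Z * ?L Y)" .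
  have "rho q X * rho q Y + rho q Y * rho q Z + rho q Z * rho q X =
    (mu X * mu Y + mu Y * mu Z + mu Z * mu X) + (?L X * ?L Y + ?L Y * ?L Z + ?L Z * ?L X)
    + (mu X * ?L Y + mu X * ?L Z + mu Y * ?L Z + mu Y * ?L X + mu Z * ?L X + mu Z * ?L Y)"
    by (simp add: rho_def algebra_simps)
  then show ?thesis unfolding L mu_triple[OF prod ne] by simp
qed

text \<open>The degenerate case \<open>Y = 1 / X\<close>, \<open>Z = 1\<close> of the double series identity. In the inner sum one of the three
terms no longer depends on the summation index and contributes the factor \<open>c - 1\<close>, which produces the
derivative of \<open>\<rho>\<close>.\<close>

lemma rho_square:
  assumes q: "norm q < 1" and n: "norm X = 1" and ne: "X \<noteq> 1"
  shows "(rho q X)\<^sup>2 = (mu X)\<^sup>2 + lambert (wave 1 X) q - 2 * cosine_series 0 q X - 2 * lambert2 (\<lambda>_. 1) q"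
proof -
  have nz: "X \<noteq> 0" using n by auto
  let ?L = "lambert (wave 0 X) q"
  let ?E = "torus_char X (inverse X)"
  have t1: "subexp (\<lambda>_. 1)" by (rule subexp_bounded[where C = 1]) auto
  have "- (?L * ?L) = double_lambert q (\<lambda>a b. - (wave 0 X a * wave 0 X b))"
    by (simp add: lambert_mult[OF q norm_wave_le norm_wave_le] n double_lambert_uminus)
  also have "\<dots> = double_lambert q (\<lambda>a b. (?E (int a) (int b) + ?E (int b) (int b - int a) + ?E (int a - int b) (int a))
         - (?E (int a) (- int b) + ?E (int b) (int a + int b) + ?E (int a + int b) (int a)))"
    by (intro double_lambert_cong)
       (simp add: torus_char_def wave_def nz power_int_add power_int_diff power_int_minus power_mult_distrib field_simps)
  also have "\<dots> = infsum (\<lambda>c. (?E (int c) (int c) + ?E (int c) 0 + ?E 0 (int c)) * (lam q c)\<^sup>2) {1..}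
       - infsum (\<lambda>c. (\<Sum>a=1..<c. ?E (int a) (int a - int c) + ?E (int c - int a) (int c) + ?E (int c) (int a)) * lam q c) {1..}"
    using n by (intro triple_identity_coefficients[where E = "?E" and C = 2] q torus_char_bound torus_char_even) (auto simp: norm_inverse)
  also have "(\<lambda>c. (?E (int c) (int c) + ?E (int c) 0 + ?E 0 (int c)) * (lam q c)\<^sup>2)
     = (\<lambda>c. (2 * 1 + 2 * cowave 0 X c) * (lam q c)\<^sup>2)"
    by (intro ext) (simp add: torus_char_def cowave_def nz power_int_minus field_simps)
  also have "infsum (\<lambda>c. (\<Sum>a=1..<c. ?E (int a) (int a - int c) + ?E (int c - int a) (int c) + ?E (int c) (int a)) * lam q c) {1..}
    = infsum (\<lambda>c. (wave 1 X c - (2 * mu X * wave 0 X c + (2 * 1 + 2 * cowave 0 X c))) * lam q c) {1..}"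
  proof (intro infsum_cong arg_cong2[where f = "(*)"] refl)
    fix c :: nat assume "c \<in> {1..}"
    then have c: "c > 0" by simp
    have "(\<Sum>a=1..<c. ?E (int a) (int a - int c) + ?E (int c - int a) (int c) + ?E (int c) (int a))
       = (\<Sum>a=1..<c. (X ^ c + inverse X ^ c) + (1 * X ^ a + 1 * inverse X ^ a)
           + (inverse X ^ c * X ^ a + X ^ c * inverse X ^ a))"
      by (intro sum.cong refl)
         (simp add: torus_char_def nz power_int_add power_int_diff power_int_minus power_mult_distrib field_simps)
    also have "\<dots> = of_nat (c - 1) * (X ^ c + inverse X ^ c) + (\<Sum>a=1..<c. 1 * X ^ a + 1 * inverse X ^ a)
      + (\<Sum>a=1..<c. inverse X ^ c * X ^ a + X ^ c * inverse X ^ a)"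
      by (simp only: sum.distrib) (simp add: algebra_simps)
    also have "\<dots> = wave 1 X c - (2 * mu X * wave 0 X c + (2 * 1 + 2 * cowave 0 X c))"
      unfolding geometric_two_sided[OF nz ne c]
      using c nz by (simp add: wave_def cowave_def of_nat_diff field_simps)
    finally show "(\<Sum>a=1..<c. ?E (int a) (int a - int c) + ?E (int c - int a) (int c) + ?E (int c) (int a)) = \<dots>" .
  qed
  also have "infsum (\<lambda>c. (2 * 1 + 2 * cowave 0 X c) * (lam q c)\<^sup>2) {1..} -
     infsum (\<lambda>c. (wave 1 X c - (2 * mu X * wave 0 X c + (2 * 1 + 2 * cowave 0 X c))) * lam q c) {1..} =
     2 * lambert2 (\<lambda>_. 1) q + 2 * cosine_series 0 q X + 2 * mu X * ?L - lambert (wave 1 X) q"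
    using subexp_wave[OF n, of 0] subexp_wave[OF n, of 1] subexp_cowave[OF n, of 0] t1 subexp_cmult[OF t1, of 2]
    by (simp add: infsum_lam_squared[OF q] infsum_lambert[OF _ q] subexp_add subexp_diff subexp_cmult
        lambert_add[OF q] lambert_diff[OF q] lambert_cmult[OF q] lambert2_add[OF q] lambert2_cmult[OF q] 
        lambert2_cmult[OF q t1, of 2, simplified] lambert_cmult[OF q t1, of 2, simplified] del: One_nat_def)
  finally show ?thesis
    by (simp add: rho_def algebra_simps power2_eq_square)
qed

section \<open>Differentiation along the unit circle\<close>

text \<open>The series converges in a disc of radius \<open>R > 1\<close>, so on the unit circle it may be differentiated
term by term.\<close>

lemma has_vector_derivative_circle_series:
  fixes w :: "nat \<Rightarrow> complex" and R :: real
  assumes R: "R > 1" and w: "summable (\<lambda>n. w n * R ^ n)"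
  shows "summable (\<lambda>n. w n * cis t ^ n)" "summable (\<lambda>n. of_nat n * w n * cis t ^ n)"
    "((\<lambda>t. \<Sum>n. w n * cis t ^ n) has_vector_derivative \<i> * (\<Sum>n. of_nat n * w n * cis t ^ n)) (at t)"
proof -
  have "summable (\<lambda>n. w n * of_real R ^ n)" using w by simp
  then obtain g g' where g: "\<And>z. norm z < R \<Longrightarrow> (\<lambda>n. w n * z ^ n) sums g z"
     "\<And>z. norm z < R \<Longrightarrow> (\<lambda>n. of_nat n * w n * z ^ (n - 1)) sums g' z"
     "\<And>z. norm z < R \<Longrightarrow> (g has_field_derivative g' z) (at z)"
    using power_series_and_derivative_0[of w R] w by blast
  have c: "norm (cis t) < R" for t using R by simp
  show 1: "summable (\<lambda>n. w n * cis t ^ n)" using g(1)[OF c] sums_summable by blast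
  have "(\<lambda>n. cis t * (of_nat n * w n * cis t ^ (n - 1))) sums (cis t * g' (cis t))"
    by (intro sums_mult g(2) c)
  moreover have "cis t * (of_nat n * w n * cis t ^ (n - 1)) = of_nat n * w n * cis t ^ n" for n
    by (cases n) simp_all
  ultimately have 2: "(\<lambda>n. of_nat n * w n * cis t ^ n) sums (cis t * g' (cis t))" by (simp only:)
  then show "summable (\<lambda>n. of_nat n * w n * cis t ^ n)" by (rule sums_summable)
  have "(cis has_vector_derivative \<i> * cis t) (at t)"
    using has_derivative_cis[OF has_derivative_ident] by (simp add: has_vector_derivative_def)
  from field_vector_diff_chain_at[OF this g(3)[OF c]]
  have "((\<lambda>t. g (cis t)) has_vector_derivative \<i> * (cis t * g' (cis t))) (at t)"
    by (simp add: o_def mult_ac)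
  moreover have "(\<lambda>t. g (cis t)) = (\<lambda>t. \<Sum>n. w n * cis t ^ n)"
    using g(1)[OF c] by (intro ext) (simp add: sums_iff)
  ultimately show "((\<lambda>t. \<Sum>n. w n * cis t ^ n) has_vector_derivative \<i> * (\<Sum>n. of_nat n * w n * cis t ^ n)) (at t)"
    using 2 by (simp add: sums_iff)
qed

text \<open>The coefficients decay geometrically, so the radius of convergence in \<open>X\<close> exceeds one even after
multiplication by powers of the index.\<close>

lemma summable_kernel:
  fixes L :: "nat \<Rightarrow> complex"
  assumes r: "0 \<le> r" "r < 1" and L: "\<And>a. norm (L a) \<le> K * r ^ a"
  obtains R :: real where "R > 1" "summable (\<lambda>n. of_nat n ^ j * L n * R ^ n)"
proof -
  define s where "s = (1 + r) / 2"
  define R where "R = 1 / s"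
  have s: "0 < s" "s < 1" "r < s" using r by (auto simp: s_def)
  have t: "subexp (\<lambda>a. of_nat a ^ j * 1 ^ a)" using subexp_pow[of 1 j] by simp
  have K: "K \<ge> 0" using order_trans[OF norm_ge_zero L[of 0]] by simp
  have "r / s < 1" using s by simp
  then obtain r' where r': "r / s < r'" "r' < 1" "0 < r'"
    using r s by (metis dense divide_nonneg_pos order_le_less_trans less_eq_real_def)
  have "summable (\<lambda>a. K * (norm (of_nat a ^ j :: complex) * r' ^ a))"
    using t r' by (intro summable_mult) (auto simp: subexp_def)
  then have "summable (\<lambda>n. of_nat n ^ j * L n * of_real R ^ n)"
  proof (rule summable_comparison_test'[where N = 0])
    fix n
    have "norm (of_nat n ^ j * L n * of_real R ^ n) = norm (of_nat n ^ j :: complex) * (norm (L n) * R ^ n)"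
      using s by (simp add: norm_mult norm_power R_def norm_divide)
    also have "\<dots> \<le> norm (of_nat n ^ j :: complex) * (K * r' ^ n)"
    proof (intro mult_left_mono)
      have "norm (L n) * R ^ n \<le> K * r ^ n * R ^ n"
        using L s by (intro mult_right_mono) (auto simp: R_def)
      also have "\<dots> = K * (r / s) ^ n" by (simp add: R_def power_divide)
      also have "\<dots> \<le> K * r' ^ n" using r' r s K by (intro mult_left_mono power_mono) auto
      finally show "norm (L n) * R ^ n \<le> K * r' ^ n" .
    qed auto
    finally show "norm (of_nat n ^ j * L n * of_real R ^ n) \<le> K * (norm (of_nat n ^ j :: complex) * r' ^ n)"
      by (simp add: mult_ac)
  qed
  moreover have "R > 1" using s by (simp add: R_def)
  ultimately show ?thesis using that by simp
qed

lemma has_vector_derivative_kernel: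
  fixes L :: "nat \<Rightarrow> complex"
  assumes r: "0 \<le> r" "r < 1" and L: "\<And>a. norm (L a) \<le> K * r ^ a"
  shows "((\<lambda>t. \<Sum>a. of_nat a ^ j * (cis t ^ a + s * inverse (cis t) ^ a) * L a) has_vector_derivative
     \<i> * (\<Sum>a. of_nat a ^ Suc j * (cis t ^ a - s * inverse (cis t) ^ a) * L a)) (at t)"
proof -
  obtain R :: real where R: "R > 1" "summable (\<lambda>n. of_nat n ^ j * L n * R ^ n)"
    using summable_kernel[OF assms] .
  note D = has_vector_derivative_circle_series[OF R]
  let ?F = "\<lambda>t. \<Sum>n. of_nat n ^ j * L n * cis t ^ n"
  let ?F' = "\<lambda>t. \<Sum>n. of_nat n * (of_nat n ^ j * L n) * cis t ^ n"
  have "((\<lambda>t. ?F t + s * ?F (- t)) has_vector_derivative (\<i> * ?F' t + s * (- (\<i> * ?F' (- t))))) (at t)"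
  proof (intro has_vector_derivative_add has_vector_derivative_mult_right D(3))
    have "((?F \<circ> uminus) has_vector_derivative (- 1) *\<^sub>R (\<i> * ?F' (- t))) (at t)"
      by (rule vector_diff_chain_at) (auto intro!: derivative_eq_intros D(3))
    then show "((\<lambda>t. ?F (- t)) has_vector_derivative - (\<i> * ?F' (- t))) (at t)"
      by (simp add: o_def)
  qed
  moreover have "?F t + s * ?F (- t) = (\<Sum>a. of_nat a ^ j * (cis t ^ a + s * inverse (cis t) ^ a) * L a)" for t
    by (subst suminf_mult[OF D(1), symmetric], subst suminf_add[OF D(1) summable_mult[OF D(1)]])
       (simp add: algebra_simps cis_inverse)
  moreover have "\<i> * ?F' t + s * (- (\<i> * ?F' (- t))) = \<i> * (\<Sum>a. of_nat a ^ Suc j * (cis t ^ a - s * inverse (cis t) ^ a) * L a)"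
  proof -
    have "\<i> * ?F' t + s * (- (\<i> * ?F' (- t))) = \<i> * (?F' t - s * ?F' (- t))" by (simp add: algebra_simps)
    also have "?F' t - s * ?F' (- t) = (\<Sum>a. of_nat a ^ Suc j * (cis t ^ a - s * inverse (cis t) ^ a) * L a)"
      by (subst suminf_mult[OF D(2), symmetric], subst suminf_diff[OF D(2) summable_mult[OF D(2)]])
         (simp add: algebra_simps cis_inverse)
    finally show ?thesis .
  qed
  ultimately show ?thesis by simp
qed

lemma has_vector_derivative_lambert_wave:
  assumes q: "norm q < 1"
  shows "((\<lambda>t. lambert (wave j (cis t)) q) has_vector_derivative \<i> * lambert (wave (Suc j) (cis t)) q) (at t)"
  using has_vector_derivative_kernel[of "norm q" "lam q" "1 / (1 - norm q)" j "- ((- 1) ^ j)" t] norm_lam_le[OF q] q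
  by (simp add: lambert_def wave_def)

lemma has_vector_derivative_lambert2_cowave:
  assumes q: "norm q < 1"
  shows "((\<lambda>t. lambert2 (cowave j (cis t)) q) has_vector_derivative \<i> * lambert2 (cowave (Suc j) (cis t)) q) (at t)"
  using has_vector_derivative_kernel[of "norm q" "lam2 q" "1 / (1 - norm q)\<^sup>2" j "(- 1) ^ j" t] norm_lam2_le[OF q] q
  by (simp add: lambert2_def cowave_def)

text \<open>The functions \<open>rho1\<close>, \<open>rho2\<close>, \<open>rho3\<close> are the iterated images of \<open>rho\<close> under \<open>X d/dX\<close>; the first
summands come from \<open>X d/dX \<mu> = \<mu>\<^sup>2 - 1/4\<close>.\<close>

definition rho1 :: "complex \<Rightarrow> complex \<Rightarrow> complex" where
  "rho1 q X = (mu X)\<^sup>2 - 1 / 4 + lambert (wave 1 X) q"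

definition rho2 :: "complex \<Rightarrow> complex \<Rightarrow> complex" where
  "rho2 q X = 2 * mu X * ((mu X)\<^sup>2 - 1 / 4) + lambert (wave 2 X) q"

definition rho3 :: "complex \<Rightarrow> complex \<Rightarrow> complex" where
  "rho3 q X = 2 * ((mu X)\<^sup>2 - 1 / 4) * (3 * (mu X)\<^sup>2 - 1 / 4) + lambert (wave 3 X) q"

text \<open>Up to affine normalisation the Eisenstein series of weight two.\<close>

abbreviation eisenstein2 :: "complex \<Rightarrow> complex" where
  "eisenstein2 q \<equiv> lambert2 (\<lambda>_. 1) q"

lemma has_vector_derivative_mu:
  assumes "cis t \<noteq> 1"
  shows "((\<lambda>t. mu (cis t)) has_vector_derivative \<i> * ((mu (cis t))\<^sup>2 - 1 / 4)) (at t)"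
proof -
  have c: "(cis has_vector_derivative \<i> * cis t) (at t)"
    using has_derivative_cis[OF has_derivative_ident] by (simp add: has_vector_derivative_def)
  have "(mu has_field_derivative 1 / (1 - cis t)\<^sup>2) (at (cis t))"
    unfolding mu_def[abs_def] using assms
    by (auto intro!: derivative_eq_intros simp: divide_simps) algebra
  from field_vector_diff_chain_at[OF c this]
  have "((\<lambda>t. mu (cis t)) has_vector_derivative \<i> * cis t * (1 / (1 - cis t)\<^sup>2)) (at t)"
    by (simp add: o_def)
  moreover have "cis t * (1 / (1 - cis t)\<^sup>2) = (mu (cis t))\<^sup>2 - 1 / 4"
    using assms by (simp add: mu_def divide_simps) algebra
  ultimately show ?thesis by (metis mult.assoc)
qed

lemma has_vector_derivative_rho:
  assumes q: "norm q < 1" and t: "cis t \<noteq> 1"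
  shows "((\<lambda>t. rho q (cis t)) has_vector_derivative \<i> * rho1 q (cis t)) (at t)"
    and "((\<lambda>t. rho1 q (cis t)) has_vector_derivative \<i> * rho2 q (cis t)) (at t)"
    and "((\<lambda>t. rho2 q (cis t)) has_vector_derivative \<i> * rho3 q (cis t)) (at t)"
proof -
  note M = has_vector_derivative_mu[OF t]
  note L = has_vector_derivative_lambert_wave[OF q, of _ t]
  have M1: "((\<lambda>t. (mu (cis t))\<^sup>2 - 1 / 4) has_vector_derivative \<i> * (2 * mu (cis t) * ((mu (cis t))\<^sup>2 - 1 / 4))) (at t)"
    using has_vector_derivative_diff[OF has_vector_derivative_mult[OF M M] has_vector_derivative_const[of "1 / 4"]]
    by (simp add: power2_eq_square algebra_simps)
  have M2: "((\<lambda>t. 2 * mu (cis t) * ((mu (cis t))\<^sup>2 - 1 / 4)) has_vector_derivative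
     \<i> * (2 * ((mu (cis t))\<^sup>2 - 1 / 4) * (3 * (mu (cis t))\<^sup>2 - 1 / 4))) (at t)"
    using has_vector_derivative_mult[OF has_vector_derivative_mult_right[OF M, of 2] M1]
    by (simp add: power2_eq_square algebra_simps)
  show "((\<lambda>t. rho q (cis t)) has_vector_derivative \<i> * rho1 q (cis t)) (at t)"
    using has_vector_derivative_add[OF M L[of 0]] by (simp add: rho_def rho1_def algebra_simps)
  show "((\<lambda>t. rho1 q (cis t)) has_vector_derivative \<i> * rho2 q (cis t)) (at t)"
    using has_vector_derivative_add[OF M1 L[of 1]] by (simp add: rho1_def rho2_def algebra_simps numeral_2_eq_2)
  show "((\<lambda>t. rho2 q (cis t)) has_vector_derivative \<i> * rho3 q (cis t)) (at t)"
    using has_vector_derivative_add[OF M2 L[of 2]] by (simp add: rho2_def rho3_def algebra_simps numeral_2_eq_2 numeral_3_eq_3)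
qed

lemma has_vector_derivative_cis_double:
  assumes "\<And>s. cis s \<noteq> 1 \<Longrightarrow> ((\<lambda>t. f (cis t)) has_vector_derivative \<i> * g (cis s)) (at s)" "cis (2 * t) \<noteq> 1"
  shows "((\<lambda>t. f (cis (2 * t))) has_vector_derivative \<i> * (2 * g (cis (2 * t)))) (at t)"
proof -
  have "(((\<lambda>t. f (cis t)) \<circ> (\<lambda>t. 2 * t)) has_vector_derivative 2 *\<^sub>R (\<i> * g (cis (2 * t)))) (at t)"
    by (rule vector_diff_chain_at) (auto intro!: derivative_eq_intros assms)
  then show ?thesis by (simp add: o_def scaleR_conv_of_real mult_ac)
qed

text \<open>Identities between functions on the circle may be differentiated along it.\<close>

lemma vector_derivatives_agree:
  fixes f g :: "real \<Rightarrow> complex"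
  assumes "(f has_vector_derivative \<i> * a) (at t)" "(g has_vector_derivative \<i> * b) (at t)"
    and "open S" "t \<in> S" "\<And>s. s \<in> S \<Longrightarrow> f s = g s"
  shows "a = b"
proof -
  have "(g has_vector_derivative \<i> * a) (at t)"
    by (rule has_vector_derivative_transform_within_open[OF assms(1,3-5)])
  then have "\<i> * a = \<i> * b" by (rule vector_derivative_unique_at[OF _ assms(2)])
  then show ?thesis by simp
qed

lemma open_cis_ne_1: "open {t. cis (k * t) \<noteq> 1}"
proof -
  have "open ((\<lambda>t. cis (k * t)) -` (- {1}))"
    by (intro open_vimage) (auto intro!: continuous_intros)
  then show ?thesis by (simp add: vimage_def)
qed

text \<open>The heat equation of the theta function: \<open>D\<close> of its logarithm, which is the series \<open>cosine_series 0\<close> up to sign and a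
term independent of \<open>X\<close>, is determined by \<open>\<rho>\<^sub>1\<close> and \<open>\<rho>\<^sup>2\<close>. The two lemmas that follow are its derivatives along the circle.\<close>

lemma heat_0:
  assumes q: "norm q < 1" and t: "cis t \<noteq> 1"
  shows "(rho q (cis t))\<^sup>2 = rho1 q (cis t) + 1 / 4 - 2 * cosine_series 0 q (cis t) - 2 * eisenstein2 q"
  using rho_square[OF q _ t] by (simp add: rho1_def)

lemma heat_1:
  assumes q: "norm q < 1" and t: "cis t \<noteq> 1"
  shows "2 * rho q (cis t) * rho1 q (cis t) = rho2 q (cis t) - 2 * cosine_series 1 q (cis t)"
proof (rule vector_derivatives_agree[where t = t and S = "{t. cis (1 * t) \<noteq> 1}"])
  note D = has_vector_derivative_rho[OF q t]
  show "((\<lambda>t. rho q (cis t) * rho q (cis t)) has_vector_derivative \<i> * (2 * rho q (cis t) * rho1 q (cis t))) (at t)"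
    using has_vector_derivative_mult[OF D(1) D(1)] by (simp add: algebra_simps)
  show "((\<lambda>t. rho1 q (cis t) - 2 * cosine_series 0 q (cis t) + (1 / 4 - 2 * eisenstein2 q)) has_vector_derivative
      \<i> * (rho2 q (cis t) - 2 * cosine_series 1 q (cis t))) (at t)"
    using has_vector_derivative_add[OF has_vector_derivative_diff[OF D(2)
        has_vector_derivative_mult_right[OF has_vector_derivative_lambert2_cowave[OF q, of 0 t], of 2]]
        has_vector_derivative_const[of "1 / 4 - 2 * eisenstein2 q"]]
    by (simp add: algebra_simps)
qed (use open_cis_ne_1[of 1] heat_0[OF q] t in \<open>auto simp: power2_eq_square\<close>)

lemma heat_2:
  assumes q: "norm q < 1" and t: "cis t \<noteq> 1"
  shows "2 * (rho1 q (cis t))\<^sup>2 + 2 * rho q (cis t) * rho2 q (cis t) = rho3 q (cis t) - 2 * cosine_series 2 q (cis t)"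
proof (rule vector_derivatives_agree[where t = t and S = "{t. cis (1 * t) \<noteq> 1}"])
  note D = has_vector_derivative_rho[OF q t]
  show "((\<lambda>t. 2 * rho q (cis t) * rho1 q (cis t)) has_vector_derivative
      \<i> * (2 * (rho1 q (cis t))\<^sup>2 + 2 * rho q (cis t) * rho2 q (cis t))) (at t)"
    using has_vector_derivative_mult[OF has_vector_derivative_mult_right[OF D(1), of 2] D(2)]
    by (simp add: algebra_simps power2_eq_square)
  show "((\<lambda>t. rho2 q (cis t) - 2 * cosine_series 1 q (cis t)) has_vector_derivative
      \<i> * (rho3 q (cis t) - 2 * cosine_series 2 q (cis t))) (at t)"
    using has_vector_derivative_diff[OF D(3)
        has_vector_derivative_mult_right[OF has_vector_derivative_lambert2_cowave[OF q, of 1 t], of 2]]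
    by (simp add: algebra_simps numeral_2_eq_2)
qed (use open_cis_ne_1[of 1] heat_1[OF q] t in \<open>auto\<close>)

lemma rho_inverse:
  assumes q: "norm q < 1" and X: "norm X = 1" "X \<noteq> 1"
  shows "rho q (inverse X) = - rho q X" "rho1 q (inverse X) = rho1 q X"
    "rho2 q (inverse X) = - rho2 q X" "rho3 q (inverse X) = rho3 q X"
proof -
  have X0: "X \<noteq> 0" using X by auto
  have w: "wave j (inverse X) = (\<lambda>a. - ((- 1) ^ j * wave j X a))" for j
    by (cases "even j") (auto simp: wave_def algebra_simps fun_eq_iff)
  have L: "lambert (wave j (inverse X)) q = - ((- 1) ^ j) * lambert (wave j X) q" for j
    unfolding w using lambert_cmult[OF q subexp_wave[OF X(1)], of "- ((- 1) ^ j)" j] by simp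
  note m = mu_inverse[OF X0 X(2)]
  show "rho q (inverse X) = - rho q X" "rho1 q (inverse X) = rho1 q X"
    "rho2 q (inverse X) = - rho2 q X" "rho3 q (inverse X) = rho3 q X"
    unfolding rho_def rho1_def rho2_def rho3_def L m by simp_all
qed

text \<open>The three-term relation at \<open>(X, X, 1 / X\<^sup>2)\<close>, with the remaining Lambert series eliminated by the heat equation.
The two lemmas that follow are its derivatives along the circle.\<close>

lemma duplication_0:
  assumes q: "norm q < 1" and t: "cis t \<noteq> 1" "cis (2 * t) \<noteq> 1"
  shows "(2 * rho q (cis t) - rho q (cis (2 * t)))\<^sup>2
    = 2 * rho1 q (cis t) + rho1 q (cis (2 * t)) - 6 * eisenstein2 q + 1 / 4"
proof -
  let ?X = "cis t" and ?Y = "cis (2 * t)"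
  have Y: "?Y = ?X * ?X" by (simp add: cis_mult)
  have "rho q ?X * rho q ?X + rho q ?X * rho q (inverse ?Y) + rho q (inverse ?Y) * rho q ?X
     = - 1 / 4 + cosine_series 0 q ?X + cosine_series 0 q ?X + cosine_series 0 q (inverse ?Y)"
  proof (rule rho_triple[OF q])
    show "?X * ?X * inverse ?Y = 1" unfolding Y by (rule right_inverse) simp
    show "inverse ?Y \<noteq> 1" using t(2) by (simp del: cis_inverse)
  qed (use t in auto)
  moreover have "rho q (inverse ?Y) = - rho q ?Y"
  proof -
    have "wave 0 (inverse ?Y) = (\<lambda>a. - wave 0 ?Y a)" by (auto simp: wave_def)
    moreover have "lambert (\<lambda>a. - wave 0 ?Y a) q = - lambert (wave 0 ?Y) q"
      using lambert_cmult[OF q subexp_wave, of ?Y "- 1" 0] by simp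
    ultimately show ?thesis unfolding rho_def using mu_inverse[of ?Y] t
      by (simp del: cis_inverse)
  qed
  moreover have "cosine_series 0 q (inverse ?Y) = cosine_series 0 q ?Y"
  proof -
    have "cowave 0 (inverse ?Y) = cowave 0 ?Y" by (auto simp: cowave_def)
    then show ?thesis by simp
  qed
  ultimately have "(rho q ?X)\<^sup>2 - 2 * rho q ?X * rho q ?Y = - 1 / 4 + 2 * cosine_series 0 q ?X + cosine_series 0 q ?Y"
    by (simp add: power2_eq_square algebra_simps)
  moreover have "2 * cosine_series 0 q ?X = rho1 q ?X + 1 / 4 - 2 * eisenstein2 q - (rho q ?X)\<^sup>2"
    "2 * cosine_series 0 q ?Y = rho1 q ?Y + 1 / 4 - 2 * eisenstein2 q - (rho q ?Y)\<^sup>2"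
    using heat_0[OF q t(1)] heat_0[OF q t(2)] by (simp_all add: algebra_simps)
  ultimately show ?thesis by algebra
qed

lemma duplication_1:
  assumes q: "norm q < 1" and t: "cis t \<noteq> 1" "cis (2 * t) \<noteq> 1"
  shows "2 * (2 * rho q (cis t) - rho q (cis (2 * t))) * (2 * rho1 q (cis t) - 2 * rho1 q (cis (2 * t)))
    = 2 * rho2 q (cis t) + 2 * rho2 q (cis (2 * t))"
proof (rule vector_derivatives_agree[where t = t and S = "{t. cis (1 * t) \<noteq> 1} \<inter> {t. cis (2 * t) \<noteq> 1}"])
  note D = has_vector_derivative_rho[OF q t(1)]
  note D2 = has_vector_derivative_cis_double[OF has_vector_derivative_rho(1)[OF q] t(2)]
    has_vector_derivative_cis_double[OF has_vector_derivative_rho(2)[OF q] t(2)]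
  note G = has_vector_derivative_diff[OF has_vector_derivative_mult_right[OF D(1), of 2] D2(1)]
  show "((\<lambda>t. (2 * rho q (cis t) - rho q (cis (2 * t))) * (2 * rho q (cis t) - rho q (cis (2 * t)))) has_vector_derivative
    \<i> * (2 * (2 * rho q (cis t) - rho q (cis (2 * t))) * (2 * rho1 q (cis t) - 2 * rho1 q (cis (2 * t))))) (at t)"
    using has_vector_derivative_mult[OF G G] by (simp add: algebra_simps)
  show "((\<lambda>t. 2 * rho1 q (cis t) + rho1 q (cis (2 * t)) + (1 / 4 - 6 * eisenstein2 q)) has_vector_derivative
    \<i> * (2 * rho2 q (cis t) + 2 * rho2 q (cis (2 * t)))) (at t)"
    using has_vector_derivative_add[OF has_vector_derivative_add[OF has_vector_derivative_mult_right[OF D(2), of 2] D2(2)]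
        has_vector_derivative_const[of "1 / 4 - 6 * eisenstein2 q"]]
    by (simp add: algebra_simps)
  show "open ({t. cis (1 * t) \<noteq> 1} \<inter> {t. cis (2 * t) \<noteq> 1})"
    by (intro open_Int open_cis_ne_1)
qed (use duplication_0[OF q] t in \<open>auto simp: power2_eq_square\<close>)

lemma duplication_2:
  assumes q: "norm q < 1" and t: "cis t \<noteq> 1" "cis (2 * t) \<noteq> 1"
  shows "2 * (2 * rho1 q (cis t) - 2 * rho1 q (cis (2 * t)))\<^sup>2
      + 2 * (2 * rho q (cis t) - rho q (cis (2 * t))) * (2 * rho2 q (cis t) - 4 * rho2 q (cis (2 * t)))
    = 2 * rho3 q (cis t) + 4 * rho3 q (cis (2 * t))"
proof (rule vector_derivatives_agree[where t = t and S = "{t. cis (1 * t) \<noteq> 1} \<inter> {t. cis (2 * t) \<noteq> 1}"])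
  note D = has_vector_derivative_rho[OF q t(1)]
  note D2 = has_vector_derivative_cis_double[OF has_vector_derivative_rho(1)[OF q] t(2)]
    has_vector_derivative_cis_double[OF has_vector_derivative_rho(2)[OF q] t(2)]
    has_vector_derivative_cis_double[OF has_vector_derivative_rho(3)[OF q] t(2)]
  note G = has_vector_derivative_diff[OF has_vector_derivative_mult_right[OF D(1), of 2] D2(1)]
  note G1 = has_vector_derivative_diff[OF has_vector_derivative_mult_right[OF D(2), of 2]
     has_vector_derivative_mult_right[OF D2(2), of 2]]
  show "((\<lambda>t. 2 * (2 * rho q (cis t) - rho q (cis (2 * t))) * (2 * rho1 q (cis t) - 2 * rho1 q (cis (2 * t)))) has_vector_derivative
    \<i> * (2 * (2 * rho1 q (cis t) - 2 * rho1 q (cis (2 * t)))\<^sup>2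
      + 2 * (2 * rho q (cis t) - rho q (cis (2 * t))) * (2 * rho2 q (cis t) - 4 * rho2 q (cis (2 * t))))) (at t)"
    using has_vector_derivative_mult[OF has_vector_derivative_mult_right[OF G, of 2] G1]
    by (simp add: algebra_simps power2_eq_square)
  show "((\<lambda>t. 2 * rho2 q (cis t) + 2 * rho2 q (cis (2 * t))) has_vector_derivative
    \<i> * (2 * rho3 q (cis t) + 4 * rho3 q (cis (2 * t)))) (at t)"
    using has_vector_derivative_add[OF has_vector_derivative_mult_right[OF D(3), of 2]
      has_vector_derivative_mult_right[OF D2(3), of 2]]
    by (simp add: algebra_simps)
  show "open ({t. cis (1 * t) \<noteq> 1} \<inter> {t. cis (2 * t) \<noteq> 1})"
    by (intro open_Int open_cis_ne_1)
qed (use duplication_1[OF q] t in auto)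

section \<open>Fifth roots of unity\<close>

lemma quintic_cis:
  assumes "cis t \<noteq> 1" "cis (5 * t) = 1"
  shows "cis (2 * t) \<noteq> 1" "cis (2 * (2 * t)) = inverse (cis t)" "cis (2 * (2 * t)) \<noteq> 1"
proof -
  have "cis t * cis (2 * (2 * t)) = 1" using assms(2) by (simp add: cis_mult)
  then show 1: "cis (2 * (2 * t)) = inverse (cis t)" by (metis inverse_unique)
  then show 2: "cis (2 * (2 * t)) \<noteq> 1" using assms(1) by (simp del: cis_inverse)
  have "cis (2 * (2 * t)) = cis (2 * t) * cis (2 * t)" by (simp add: cis_mult)
  then show "cis (2 * t) \<noteq> 1" using 2 by auto
qed

text \<open>The duplication formula at \<open>t\<close> and at \<open>2 t\<close>, where \<open>cis (4 t) = inverse (cis t)\<close> closes the cycle: \<open>\<rho>\<close> and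
\<open>\<rho>\<^sub>2\<close> change sign under inversion, \<open>\<rho>\<^sub>1\<close> and \<open>\<rho>\<^sub>3\<close> do not. At each order of differentiation these are two
linear equations for the highest derivatives at \<open>\<zeta>\<close> and \<open>\<zeta>\<^sup>2\<close>; the undifferentiated ones also contain
the weight two Eisenstein series, so that one unknown
\<open>p\<close> remains.\<close>

lemma quintic_relations:
  assumes q: "norm q < 1" and t: "cis t \<noteq> 1" "cis (5 * t) = 1"
  defines "a \<equiv> rho q (cis t)" and "b \<equiv> rho q (cis (2 * t))"
    and "p \<equiv> rho1 q (cis (2 * t))"
  defines "d \<equiv> 3 * a\<^sup>2 - 8 * a * b - 3 * b\<^sup>2"
  shows "rho1 q (cis t) = p + d"
    and "6 * eisenstein2 q = 3 * p + 2 * d + 1 / 4 - (2 * a - b)\<^sup>2"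
    and "rho2 q (cis t) = (3 * a + b) * d"
    and "rho2 q (cis (2 * t)) = (a - 3 * b) * d"
    and "3 * rho3 q (cis t) = 4 * d\<^sup>2 + 4 * (a + 2 * b) * (7 * a - b) * d - 2 * (2 * a - b) * (a + 7 * b) * d"
    and "3 * rho3 q (cis (2 * t)) = 4 * d\<^sup>2 + 4 * (2 * a - b) * (a + 7 * b) * d - 2 * (a + 2 * b) * (7 * a - b) * d"
proof -
  note c = quintic_cis[OF t]
  have n: "norm (cis t) = 1" by simp
  note inv = rho_inverse[OF q n t(1), folded c(2)]
  note e = duplication_0[OF q t(1) c(1)] duplication_0[OF q c(1,3)]
    duplication_1[OF q t(1) c(1)] duplication_1[OF q c(1,3)]
    duplication_2[OF q t(1) c(1)] duplication_2[OF q c(1,3)]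
  note e = e[unfolded inv, folded a_def b_def p_def]
  have p1: "rho1 q (cis t) = p + d"
    using e(1,2) unfolding d_def by algebra
  then show "rho1 q (cis t) = p + d" .
  note e = e[unfolded p1]
  show "6 * eisenstein2 q = 3 * p + 2 * d + 1 / 4 - (2 * a - b)\<^sup>2"
    using e(1) by (simp add: algebra_simps)
  have "4 * rho2 q (cis t) = 4 * ((3 * a + b) * d)" "4 * rho2 q (cis (2 * t)) = 4 * ((a - 3 * b) * d)"
    using e(3,4) by algebra+
  then show s: "rho2 q (cis t) = (3 * a + b) * d" "rho2 q (cis (2 * t)) = (a - 3 * b) * d"
    by simp_all
  note e = e[unfolded s]
  have "2 * (3 * rho3 q (cis t)) = 2 * (4 * d\<^sup>2 + 4 * (a + 2 * b) * (7 * a - b) * d - 2 * (2 * a - b) * (a + 7 * b) * d)"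
    "2 * (3 * rho3 q (cis (2 * t))) = 2 * (4 * d\<^sup>2 + 4 * (2 * a - b) * (a + 7 * b) * d - 2 * (a + 2 * b) * (7 * a - b) * d)"
    using e(5,6) by algebra+
  then show "3 * rho3 q (cis t) = 4 * d\<^sup>2 + 4 * (a + 2 * b) * (7 * a - b) * d - 2 * (2 * a - b) * (a + 7 * b) * d"
    "3 * rho3 q (cis (2 * t)) = 4 * d\<^sup>2 + 4 * (2 * a - b) * (a + 7 * b) * d - 2 * (a + 2 * b) * (7 * a - b) * d"
    by (metis mult_cancel_left zero_neq_numeral)+
qed

definition zeta5 :: complex where "zeta5 = cis (2 * pi / 5)"

text \<open>The number \<open>x = 2 cos (2 \<pi> / 5)\<close> satisfies \<open>x\<^sup>2 + x = 1\<close> and is positive, which selects the sign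
of the square root of five.\<close>

lemma zeta5_facts:
  shows "norm zeta5 = 1" "zeta5 \<noteq> 0" "zeta5 \<noteq> 1" "zeta5 ^ 4 + zeta5 ^ 3 + zeta5 ^ 2 + zeta5 + 1 = 0"
    "of_real (sqrt 5) = 2 * (zeta5 + inverse zeta5) + 1" "inverse zeta5 = zeta5 ^ 4" "inverse (zeta5 ^ 2) = zeta5 ^ 3"
proof -
  define x where "x = 2 * cos (2 * pi / 5)"
  have z5: "zeta5 ^ 5 = 1" using Complex.DeMoivre[of "2 * pi / 5" 5] by (simp add: zeta5_def)
  have c0: "cos (2 * pi / 5) > 0" by (intro cos_gt_zero) auto
  have s0: "sin (2 * pi / 5) > 0" by (intro sin_gt_zero) auto
  show z1: "zeta5 \<noteq> 1" using s0 by (auto simp: zeta5_def complex_eq_iff)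
  show "norm zeta5 = 1" by (simp add: zeta5_def)
  show z0: "zeta5 \<noteq> 0" by (simp add: zeta5_def)
  have sm: "zeta5 + inverse zeta5 = of_real x"
    by (simp add: zeta5_def x_def complex_eq_iff)
  have "(zeta5 - 1) * (zeta5 ^ 4 + zeta5 ^ 3 + zeta5 ^ 2 + zeta5 + 1) = zeta5 ^ 5 - 1" by algebra
  then show p: "zeta5 ^ 4 + zeta5 ^ 3 + zeta5 ^ 2 + zeta5 + 1 = 0" using z5 z1 by simp
  have "zeta5 ^ 2 * ((zeta5 + inverse zeta5)\<^sup>2 + (zeta5 + inverse zeta5) - 1) = zeta5 ^ 4 + zeta5 ^ 3 + zeta5 ^ 2 + zeta5 + 1"
    using z0 by (simp add: field_simps power2_eq_square power3_eq_cube power4_eq_xxxx)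
  then have "(of_real x :: complex)\<^sup>2 + of_real x - 1 = 0" using p z0 sm by simp
  then have "of_real (x\<^sup>2 + x - 1) = (0 :: complex)" by simp
  then have "x\<^sup>2 + x - 1 = 0" unfolding of_real_eq_0_iff .
  then have "(2 * x + 1)\<^sup>2 = 5" by algebra
  moreover have "2 * x + 1 > 0" using c0 by (simp add: x_def)
  ultimately have x: "2 * x + 1 = sqrt 5" by (simp add: real_sqrt_unique)
  show "of_real (sqrt 5) = 2 * (zeta5 + inverse zeta5) + 1"
    unfolding sm x[symmetric] by simp
  show "inverse zeta5 = zeta5 ^ 4" by (rule inverse_unique) (use z5 in algebra)
  show "inverse (zeta5 ^ 2) = zeta5 ^ 3" by (rule inverse_unique) (use z5 in algebra)
qed

lemma zeta5_angles:
  "cis (2 * pi / 5) = zeta5" "cis (2 * (2 * pi / 5)) = zeta5\<^sup>2" "cis (2 * (2 * (2 * pi / 5))) = inverse zeta5"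
  "cis (2 * pi / 5) \<noteq> 1" "cis (5 * (2 * pi / 5)) = 1" "cis (2 * (2 * pi / 5)) \<noteq> 1" "cis (5 * (2 * (2 * pi / 5))) = 1"
  "inverse zeta5 = (zeta5\<^sup>2)\<^sup>2"
proof -
  show 1: "cis (2 * pi / 5) = zeta5" by (simp add: zeta5_def)
  show 2: "cis (2 * (2 * pi / 5)) = zeta5\<^sup>2" unfolding power2_eq_square zeta5_def cis_mult by simp
  show 4: "cis (2 * pi / 5) \<noteq> 1" using zeta5_facts(3) unfolding 1 .
  show 5: "cis (5 * (2 * pi / 5)) = 1" by simp
  show 3: "cis (2 * (2 * (2 * pi / 5))) = inverse zeta5" using quintic_cis(2)[OF 4 5] unfolding 1 .
  show "cis (2 * (2 * pi / 5)) \<noteq> 1" by (rule quintic_cis(1)[OF 4 5])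
  have "cis (5 * (2 * (2 * pi / 5))) = cis (5 * (2 * pi / 5)) * cis (5 * (2 * pi / 5))"
    unfolding cis_mult by simp
  then show "cis (5 * (2 * (2 * pi / 5))) = 1" unfolding 5 by simp
  show "inverse zeta5 = (zeta5\<^sup>2)\<^sup>2" unfolding zeta5_facts(6) by simp
qed

text \<open>The factors in the two products are \<open>1 - 2 cos (2 \<pi> k / 5) x + x\<^sup>2\<close> for \<open>k = 2\<close> and \<open>k = 1\<close>.\<close>

lemma golden_factors:
  shows "1 + of_real ((1 + sqrt 5) / 2) * x + x\<^sup>2 = (1 - zeta5\<^sup>2 * x) * (1 - inverse (zeta5\<^sup>2) * x)"
    and "1 + of_real ((1 - sqrt 5) / 2) * x + x\<^sup>2 = (1 - zeta5 * x) * (1 - inverse zeta5 * x)"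
    and "1 - x ^ 5 = (1 - 1 * x) * ((1 - zeta5 * x) * (1 - inverse zeta5 * x)) * ((1 - zeta5\<^sup>2 * x) * (1 - inverse (zeta5\<^sup>2) * x))"
proof -
  note f = zeta5_facts(4,5)[unfolded zeta5_facts(6)]
  have h: "of_real ((1 + sqrt 5) / 2) = (1 + of_real (sqrt 5) :: complex) / 2"
    "of_real ((1 - sqrt 5) / 2) = (1 - of_real (sqrt 5) :: complex) / 2" by simp_all
  show "1 + of_real ((1 + sqrt 5) / 2) * x + x\<^sup>2 = (1 - zeta5\<^sup>2 * x) * (1 - inverse (zeta5\<^sup>2) * x)"
    unfolding h f(2) zeta5_facts(6,7) using f(1) by algebra
  show "1 + of_real ((1 - sqrt 5) / 2) * x + x\<^sup>2 = (1 - zeta5 * x) * (1 - inverse zeta5 * x)"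
    unfolding h f(2) zeta5_facts(6,7) using f(1) by algebra
  show "1 - x ^ 5 = (1 - 1 * x) * ((1 - zeta5 * x) * (1 - inverse zeta5 * x)) * ((1 - zeta5\<^sup>2 * x) * (1 - inverse (zeta5\<^sup>2) * x))"
    unfolding zeta5_facts(6,7) using f(1) by algebra
qed

text \<open>The constant in front of the product for \<open>f\<close> is the quotient of the constant terms of the two weight one
forms, up to sign.\<close>

lemma root_mu:
  "root_plus * (3 * mu (zeta5 ^ 2) - mu zeta5) = - (3 * mu zeta5 + mu (zeta5 ^ 2))"
  "3 * mu zeta5 + mu (zeta5 ^ 2) \<noteq> 0" "3 * mu (zeta5 ^ 2) - mu zeta5 \<noteq> 0"
proof -
  note z = zeta5_facts
  define s where "s = zeta5 + inverse zeta5"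
  have s: "2 * s + 1 = of_real (sqrt 5)" using z(5) by (simp add: s_def)
  have r: "root_plus = 8 + 5 * s"
  proof -
    have "root_plus = (11 + 5 * (2 * s + 1)) / 2" unfolding s by (simp add: root_plus_def)
    then have "2 * root_plus = 2 * (8 + 5 * s)" by (simp add: algebra_simps)
    then show ?thesis unfolding mult_cancel_left by simp
  qed
  have zs: "zeta5 * s = 1 + zeta5 ^ 2" using z(2) by (simp add: s_def power2_eq_square algebra_simps)
  have "(zeta5 + 1) * (zeta5 ^ 3 + zeta5) = - 1" using z(4) by algebra
  then have nz: "1 - zeta5 \<noteq> 0" "1 + zeta5 \<noteq> 0" using z(3) by (auto simp: add.commute)
  have sq: "1 - zeta5 ^ 2 = (1 - zeta5) * (1 + zeta5)" by algebra
  define k where "k = 2 * (1 - zeta5) * (1 + zeta5)"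
  have k: "k \<noteq> 0" using nz by (simp add: k_def)
  have m1: "k * mu zeta5 = (1 + zeta5) ^ 2" using nz by (simp add: mu_def k_def power2_eq_square)
  have m2: "k * mu (zeta5 ^ 2) = 1 + zeta5 ^ 2" using nz by (simp add: mu_def k_def sq)
  have num: "k * (3 * mu zeta5 + mu (zeta5 ^ 2)) = 2 * zeta5 * (2 * s + 3)"
  proof -
    have "k * (3 * mu zeta5 + mu (zeta5 ^ 2)) = 3 * (k * mu zeta5) + k * mu (zeta5 ^ 2)" by (simp add: algebra_simps)
    then show ?thesis unfolding m1 m2 using zs by algebra
  qed
  have den: "k * (3 * mu (zeta5 ^ 2) - mu zeta5) = 2 * zeta5 * (s - 1)"
  proof -
    have "k * (3 * mu (zeta5 ^ 2) - mu zeta5) = 3 * (k * mu (zeta5 ^ 2)) - k * mu zeta5" by (simp add: algebra_simps)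
    then show ?thesis unfolding m1 m2 using zs by algebra
  qed
  have "(2 * s + 1)\<^sup>2 = 5" unfolding s by (simp flip: of_real_power)
  then have "5 * ((2 * s + 1)\<^sup>2 - 5) = 0" by simp
  then have "4 * ((8 + 5 * s) * (s - 1)) = 4 * (- (2 * s + 3))"
    by (simp add: power2_eq_square algebra_simps)
  then have "(8 + 5 * s) * (s - 1) = - (2 * s + 3)" unfolding mult_cancel_left by simp
  then have "root_plus * (2 * zeta5 * (s - 1)) = - (2 * zeta5 * (2 * s + 3))" unfolding r by algebra
  then have "k * (root_plus * (3 * mu (zeta5 ^ 2) - mu zeta5)) = k * (- (3 * mu zeta5 + mu (zeta5 ^ 2)))"
    unfolding num[symmetric] den[symmetric] by (simp add: algebra_simps)
  then show "root_plus * (3 * mu (zeta5 ^ 2) - mu zeta5) = - (3 * mu zeta5 + mu (zeta5 ^ 2))"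
    using k by (simp only: mult_cancel_left) simp
  have "2 * s + 3 \<noteq> 0"
  proof
    assume "2 * s + 3 = 0"
    moreover have "2 * s + 3 = (2 * s + 1) + 2" by simp
    then have "2 * s + 3 = of_real (sqrt 5 + 2)" unfolding s by simp
    ultimately have "of_real (sqrt 5 + 2) = (0 :: complex)" by simp
    then have "sqrt 5 + 2 = 0" unfolding of_real_eq_0_iff .
    moreover have "sqrt 5 \<ge> 0" by simp
    ultimately show False by linarith
  qed
  then show "3 * mu zeta5 + mu (zeta5 ^ 2) \<noteq> 0" using num z(2) by auto
  have "s - 1 \<noteq> 0"
  proof
    assume "s - 1 = 0"
    then have "s = 1" by simp
    then have "of_real (sqrt 5) = (of_real 3 :: complex)" using s by simp
    then have "sqrt 5 = 3" unfolding of_real_eq_iff .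
    then have "(sqrt 5)\<^sup>2 = 3\<^sup>2" by simp
    then show False by simp
  qed
  then show "3 * mu (zeta5 ^ 2) - mu zeta5 \<noteq> 0" using den z(2) by auto
qed

section \<open>Infinite products as exponentials of Lambert series\<close>

text \<open>The closed form of \<open>\<Prod>n\<ge>1. (1 - X q^n)\<close> obtained by taking logarithms.\<close>

definition euler_prod :: "complex \<Rightarrow> complex \<Rightarrow> complex" where
  "euler_prod q X = exp (- lambert (\<lambda>a. X ^ a / of_nat a) q)"

lemma subexp_euler: "norm X = 1 \<Longrightarrow> subexp (\<lambda>a. X ^ a / of_nat a)"
proof (rule subexp_bounded[where C = 1])
  fix a :: nat assume "norm X = 1"
  then show "norm (X ^ a / of_nat a) \<le> 1"
    by (cases "a = 0") (auto simp: norm_divide norm_power)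
qed

text \<open>The logarithm of the factor with index \<open>n\<close> is \<open>- (\<Sum>m. (X q^n)^m / m)\<close>; interchanging the two summations
leaves a geometric series in \<open>n\<close>.\<close>

lemma euler_product:
  assumes q: "norm q < 1" and X: "norm X = 1"
  shows "(\<lambda>n. 1 - X * q ^ Suc n) has_prod euler_prod q X"
proof -
  define F where "F = (\<lambda>n m. X ^ m / of_nat m * (q ^ m) ^ Suc n)"
  note geometric_pairs_summable[OF q]
  then have "(\<lambda>x. norm (case x of (n, m) \<Rightarrow> F n m)) summable_on UNIV \<times> UNIV"
  proof (rule summable_on_comparison_test)
    fix x :: "nat \<times> nat"
    obtain n m where x: "x = (n, m)" by force
    have "norm (F n m) \<le> norm q ^ n * norm q ^ m"
    proof (cases "m = 0")
      case False
      have "norm (F n m) = norm q ^ (m * Suc n) / real m"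
        unfolding F_def norm_mult norm_divide norm_power X power_mult[symmetric] by simp
      also have "\<dots> \<le> norm q ^ (m * Suc n)"
        using False by (intro divide_le_eq_1_pos[THEN iffD2, THEN order_trans] mult_imp_div_pos_le) (auto simp: mult_le_cancel_left1)
      also have "\<dots> \<le> norm q ^ (n + m)"
        \<comment> \<open>The exponent \<open>m (n + 1)\<close> is at least \<open>n + m\<close> since \<open>m > 0\<close>.\<close>
        using False q by (intro power_decreasing) (auto simp: algebra_simps)
      finally show ?thesis by (simp add: power_add)
    qed (simp add: F_def)
    then show "norm (case x of (n, m) \<Rightarrow> F n m) \<le> (case x of (n, m) \<Rightarrow> norm q ^ n * norm q ^ m)"
      by (simp add: x)
  qed auto
  then have sF: "(\<lambda>(n, m). F n m) summable_on UNIV \<times> UNIV"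
    by (rule abs_summable_summable)
  have sF': "(\<lambda>(m, n). F n m) summable_on UNIV \<times> UNIV"
    using summable_on_swap[THEN iffD1, OF sF] by (simp add: case_prod_unfold)
  have row: "infsum (F n) UNIV = - ln (1 - X * q ^ Suc n)" for n
  proof -
    have "norm (X * q ^ Suc n) < 1"
      using q X power_less_one_iff[of "norm q" "Suc n"] by (simp add: norm_mult norm_power del: power_Suc)
    then have "(\<lambda>m. - ((X * q ^ Suc n) ^ m) / of_nat m) sums ln (1 - X * q ^ Suc n)"
      using Ln_series'[of "- (X * q ^ Suc n)"] by (simp del: power_Suc)
    from sums_minus[OF this] have "F n sums (- ln (1 - X * q ^ Suc n))"
      by (simp add: F_def power_mult_distrib power_mult[symmetric] mult.commute del: power_Suc)
    moreover have "(F n has_sum infsum (F n) UNIV) UNIV"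
      using summable_on_SigmaD1[OF sF, of n] by simp
    ultimately show ?thesis using has_sum_imp_sums sums_unique2 by blast
  qed
  have col: "infsum (\<lambda>n. F n m) UNIV = X ^ m / of_nat m * lam q m" for m
  proof (cases "m = 0")
    case False
    have "norm (q ^ m) < 1" using q False by (simp add: norm_power power_less_one_iff)
    from sums_mult[OF geometric_sums[OF this], of "q ^ m"]
    have "(\<lambda>n. (q ^ m) ^ Suc n) sums lam q m" by (simp add: lam_def)
    from sums_mult[OF this] have "(\<lambda>n. F n m) sums (X ^ m / of_nat m * lam q m)" unfolding F_def .
    moreover have "((\<lambda>n. F n m) has_sum infsum (\<lambda>n. F n m) UNIV) UNIV"
      using summable_on_SigmaD1[OF sF', of m] by simp
    ultimately show ?thesis using has_sum_imp_sums sums_unique2 by blast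
  qed (simp add: F_def)
  have "infsum (\<lambda>n. infsum (F n) UNIV) UNIV = infsum (\<lambda>m. infsum (\<lambda>n. F n m) UNIV) UNIV"
    by (rule infsum_swap_banach[OF sF])
  also have "\<dots> = lambert (\<lambda>a. X ^ a / of_nat a) q"
    unfolding col by (subst infsum_lambert[OF subexp_euler[OF X] q, symmetric])
       (rule infsum_cong_neutral; auto simp: Suc_le_eq)
  finally have tot: "infsum (\<lambda>n. - ln (1 - X * q ^ Suc n)) UNIV = lambert (\<lambda>a. X ^ a / of_nat a) q"
    unfolding row .
  have "(\<lambda>n. - ln (1 - X * q ^ Suc n)) summable_on UNIV"
    using summable_on_Sigma_banach[OF sF] unfolding row .
  then have "(\<lambda>n. - ln (1 - X * q ^ Suc n)) sums lambert (\<lambda>a. X ^ a / of_nat a) q"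
    using has_sum_infsum has_sum_imp_sums tot by metis
  from sums_minus[OF this] have "(\<lambda>n. ln (1 - X * q ^ Suc n)) sums - lambert (\<lambda>a. X ^ a / of_nat a) q"
    by simp
  then have "raw_has_prod (\<lambda>n. exp (ln (1 - X * q ^ Suc n))) 0 (exp (- lambert (\<lambda>a. X ^ a / of_nat a) q))"
    by (rule sums_imp_has_prod_exp)
  moreover have "exp (ln (1 - X * q ^ Suc n)) = 1 - X * q ^ Suc n" for n
  proof -
    have "norm (X * q ^ Suc n) < 1"
      using q X power_less_one_iff[of "norm q" "Suc n"] by (simp add: norm_mult norm_power del: power_Suc)
    then have "1 - X * q ^ Suc n \<noteq> 0" by auto
    then show ?thesis by simp
  qed
  ultimately show ?thesis unfolding has_prod_def euler_prod_def by simp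
qed

text \<open>The coefficients of the logarithm of
\<open>(\<Prod>n. 1 - q^n)\<^sup>2 (\<Prod>n. (1 - z\<^sup>2 q^n) (1 - z^(-2) q^n))\<^sup>2 / (\<Prod>n. (1 - z q^n) (1 - z^(-1) q^n))^3\<close>.
For a fifth root of unity \<open>z\<close> this is what the product for \<open>T\<close> becomes when \<open>1 - q^(5 n)\<close> is factored.\<close>

definition weight1_coeff :: "complex \<Rightarrow> nat \<Rightarrow> complex" where
  "weight1_coeff z a = 3 * (z ^ a / of_nat a + inverse z ^ a / of_nat a)
     - 2 * ((z\<^sup>2) ^ a / of_nat a + (inverse (z\<^sup>2)) ^ a / of_nat a) - 2 * (1 ^ a / of_nat a)"

lemma subexp_weight1_coeff:
  assumes "norm z = 1" shows "subexp (weight1_coeff z)"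
  unfolding weight1_coeff_def[abs_def] using assms
  by (intro subexp_diff subexp_add subexp_cmult subexp_euler) (auto simp: norm_inverse norm_power)

lemma lambert2_weight1_coeff:
  assumes q: "norm q < 1" and z: "norm z = 1"
  shows "lambert2 (\<lambda>a. of_nat a * weight1_coeff z a) q = 3 * cosine_series 0 q z - 2 * cosine_series 0 q (z\<^sup>2) - 2 * eisenstein2 q"
proof -
  have z2: "norm (z\<^sup>2) = 1" using z by (simp add: norm_power)
  have t1: "subexp (\<lambda>_. 1)" by (rule subexp_bounded[where C = 1]) auto
  note t = subexp_cowave[OF z, of 0] subexp_cowave[OF z2, of 0] t1
  have "of_nat a * weight1_coeff z a * lam2 q a = (3 * cowave 0 z a + (- 2) * cowave 0 (z\<^sup>2) a + (- 2) * 1) * lam2 q a" for a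
  proof (cases "a = 0")
    case False
    then have k: "of_nat a * inverse (of_nat a) = (1 :: complex)" by simp
    have "of_nat a * weight1_coeff z a = 3 * cowave 0 z a + (- 2) * cowave 0 (z\<^sup>2) a + (- 2) * 1"
    proof -
      have "of_nat a * weight1_coeff z a = (of_nat a * inverse (of_nat a)) *
          (3 * (z ^ a + inverse z ^ a) - 2 * ((z\<^sup>2) ^ a + inverse (z\<^sup>2) ^ a) - 2)"
        by (simp add: weight1_coeff_def divide_inverse algebra_simps)
      then show ?thesis unfolding k by (simp add: cowave_def)
    qed
    then show ?thesis by simp
  qed (simp add: lam2_def)
  then have "lambert2 (\<lambda>a. of_nat a * weight1_coeff z a) q
    = lambert2 (\<lambda>a. 3 * cowave 0 z a + (- 2) * cowave 0 (z\<^sup>2) a + (- 2) * 1) q"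
    unfolding lambert2_def by (simp only:)
  also have "\<dots> = 3 * cosine_series 0 q z + (- 2) * cosine_series 0 q (z\<^sup>2) + (- 2) * eisenstein2 q"
    by (simp only: lambert2_add[OF q] lambert2_cmult[OF q] t subexp_add subexp_cmult)
  finally show ?thesis by simp
qed

lemma exp_weight1_coeff:
  assumes q: "norm q < 1" and z: "norm z = 1"
  shows "exp (lambert (weight1_coeff z) q) =
    (euler_prod q 1)\<^sup>2 * (euler_prod q (z\<^sup>2) * euler_prod q (inverse (z\<^sup>2)))\<^sup>2 / (euler_prod q z * euler_prod q (inverse z)) ^ 3"
proof -
  have n: "norm (inverse z) = 1" "norm (z\<^sup>2) = 1" "norm (inverse (z\<^sup>2)) = 1" "norm (1 :: complex) = 1"
    using z by (auto simp: norm_inverse norm_power)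
  note t = subexp_euler[OF z] subexp_euler[OF n(1)] subexp_euler[OF n(2)] subexp_euler[OF n(3)] subexp_euler[OF n(4)]
  let ?l = "\<lambda>X. lambert (\<lambda>a. X ^ a / of_nat a) q"
  have l: "lambert (weight1_coeff z) q = 3 * (?l z + ?l (inverse z)) - 2 * (?l (z\<^sup>2) + ?l (inverse (z\<^sup>2))) - 2 * ?l 1"
    unfolding weight1_coeff_def[abs_def]
    by (simp only: lambert_diff[OF q] lambert_add[OF q] lambert_cmult[OF q] t subexp_add subexp_cmult subexp_diff)
  have exp3: "exp (3 * x) = exp x ^ 3" and exp2: "exp (2 * x) = (exp x)\<^sup>2" for x :: complex
    using exp_of_nat_mult[of 3 x] exp_of_nat_mult[of 2 x] by simp_all
  show ?thesis
    unfolding l euler_prod_def exp_diff exp_minus exp3 exp2 exp_add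
    by (simp add: field_simps)
qed

text \<open>Both sides satisfy the same homogeneous linear differential equation of first order in \<open>q\<close>: the
logarithmic derivative of the product is known from its Lambert series, and the heat equation together
with the quintic relations shows that the linear form has the same one. The equation is singular at
\<open>q = 0\<close>, but the quotient is continuous there, so its vanishing derivative elsewhere makes it
constant; its value at \<open>q = 0\<close> is the constant term of the linear form.\<close>

lemma linear_form_product:
  assumes t: "cis t \<noteq> 1" "cis (5 * t) = 1" and q: "norm q < 1"
  shows "3 * rho q (cis t) + rho q (cis (2 * t))
    = (3 * mu (cis t) + mu (cis (2 * t))) * exp (lambert (weight1_coeff (cis t)) q)"
proof -
  let ?z = "cis t" and ?w = "cis (2 * t)"
  have w: "?z\<^sup>2 = ?w" by (simp add: power2_eq_square cis_mult)
  have n: "norm ?z = 1" "norm ?w = 1" by auto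
  let ?c = "weight1_coeff ?z"
  define F where "F = (\<lambda>q. (3 * rho q ?z + rho q ?w) * exp (- lambert ?c q))"
  have D: "\<exists>D. (F has_field_derivative D) (at q) \<and> q * D = 0" if q: "norm q < 1" for q
  proof -
    obtain D1 where D1: "(lambert (wave 0 ?z) has_field_derivative D1) (at q)" "q * D1 = cosine_series 1 q ?z"
      using has_field_derivative_lambert[OF subexp_wave[OF n(1)] q] by (auto simp: index_times_wave)
    obtain D2 where D2: "(lambert (wave 0 ?w) has_field_derivative D2) (at q)" "q * D2 = cosine_series 1 q ?w"
      using has_field_derivative_lambert[OF subexp_wave[OF n(2)] q] by (auto simp: index_times_wave)
    obtain D3 where D3: "(lambert ?c has_field_derivative D3) (at q)"
        "q * D3 = 3 * cosine_series 0 q ?z - 2 * cosine_series 0 q ?w - 2 * eisenstein2 q"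
      using has_field_derivative_lambert[OF subexp_weight1_coeff[OF n(1)] q] lambert2_weight1_coeff[OF q n(1)]
      unfolding w by auto
    have "(F has_field_derivative (3 * D1 + D2) * exp (- lambert ?c q)
        + (3 * rho q ?z + rho q ?w) * (exp (- lambert ?c q) * (- D3))) (at q)"
      unfolding F_def rho_def by (rule derivative_eq_intros D1(1) D2(1) D3(1) refl)+ (simp add: algebra_simps)
    moreover have "q * ((3 * D1 + D2) * exp (- lambert ?c q)
        + (3 * rho q ?z + rho q ?w) * (exp (- lambert ?c q) * (- D3))) = 0"
    proof -
      note R = quintic_relations[OF q t]
      note c = quintic_cis[OF t]
      \<comment> \<open>The factor 6 clears the denominators in the quintic relations.\<close>
      have "6 * (3 * cosine_series 1 q ?z + cosine_series 1 q ?w) = 6 * ((3 * rho q ?z + rho q ?w) * (3 * cosine_series 0 q ?z - 2 * cosine_series 0 q ?w - 2 * eisenstein2 q))"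
        using R(1-4) heat_0[OF q t(1)] heat_0[OF q c(1)] heat_1[OF q t(1)] heat_1[OF q c(1)] by algebra
      then have "3 * cosine_series 1 q ?z + cosine_series 1 q ?w = (3 * rho q ?z + rho q ?w) * (3 * cosine_series 0 q ?z - 2 * cosine_series 0 q ?w - 2 * eisenstein2 q)"
        unfolding mult_cancel_left by simp
      then have "3 * (q * D1) + q * D2 - (3 * rho q ?z + rho q ?w) * (q * D3) = 0"
        unfolding D1 D2 D3 by simp
      then have "exp (- lambert ?c q) * (3 * (q * D1) + q * D2 - (3 * rho q ?z + rho q ?w) * (q * D3)) = 0"
        by simp
      then show ?thesis by (simp add: algebra_simps)
    qed
    ultimately show ?thesis by blast
  qed
  have "continuous_on (ball 0 1) F"
    using D by (intro continuous_at_imp_continuous_on) (metis DERIV_isCont dist_0_norm mem_ball)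
  moreover have "\<forall>x\<in>ball 0 1 - {0}. (F has_field_derivative 0) (at x)"
    using D by force
  ultimately obtain k where k: "\<And>x. x \<in> ball 0 1 \<Longrightarrow> F x = k"
    using DERIV_zero_connected_constant[of "ball 0 1" "{0}" F] by auto
  have "F q = F 0" using k[of q] k[of 0] q by simp
  also have "F 0 = 3 * mu ?z + mu ?w" by (simp add: F_def rho_def)
  finally show ?thesis by (simp add: F_def exp_minus field_simps)
qed

section \<open>The functions f and T as forms of weight one\<close>

lemma nome_norm: "\<tau> \<in> upper_half_plane \<Longrightarrow> norm (nome \<tau>) < 1"
  by (simp add: upper_half_plane_def nome_def)

definition rho_zeta :: "complex \<Rightarrow> complex" where "rho_zeta q = rho q zeta5"

definition rho_zeta2 :: "complex \<Rightarrow> complex" where "rho_zeta2 q = rho q (zeta5\<^sup>2)"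

text \<open>Replacing \<open>\<zeta>\<close> by \<open>\<zeta>\<^sup>2\<close> sends \<open>(\<rho>(\<zeta>), \<rho>(\<zeta>\<^sup>2))\<close> to \<open>(\<rho>(\<zeta>\<^sup>2), - \<rho>(\<zeta>))\<close>, so the second formula is the first
one for another root of unity.\<close>

lemma weight1_products:
  assumes q: "norm q < 1"
  shows "3 * rho_zeta q + rho_zeta2 q = (3 * mu zeta5 + mu (zeta5\<^sup>2)) * exp (lambert (weight1_coeff zeta5) q)"
    and "3 * rho_zeta2 q - rho_zeta q = (3 * mu (zeta5\<^sup>2) - mu zeta5) * exp (lambert (weight1_coeff (zeta5\<^sup>2)) q)"
  using linear_form_product[OF zeta5_angles(4,5) q, unfolded zeta5_angles(1,2)]
    linear_form_product[OF zeta5_angles(6,7) q, unfolded zeta5_angles(2,3)]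
    rho_inverse(1)[OF q zeta5_facts(1,3)] mu_inverse[OF zeta5_facts(2,3)]
  by (simp_all add: rho_zeta_def rho_zeta2_def)

lemma f_fun_eq:
  assumes "\<tau> \<in> upper_half_plane"
  defines "q \<equiv> nome \<tau>"
  shows "f_fun \<tau> = - (3 * rho_zeta q + rho_zeta2 q) / (3 * rho_zeta2 q - rho_zeta q)"
    and "3 * rho_zeta q + rho_zeta2 q \<noteq> 0" and "3 * rho_zeta2 q - rho_zeta q \<noteq> 0"
proof -
  have q: "norm q < 1" unfolding q_def by (rule nome_norm[OF assms(1)])
  have n: "norm zeta5 = 1" "norm (inverse zeta5) = 1" "norm (zeta5\<^sup>2) = 1" "norm (inverse (zeta5\<^sup>2)) = 1"
    using zeta5_facts(1) by (auto simp: norm_inverse norm_power)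
  let ?E1 = "euler_prod q zeta5 * euler_prod q (inverse zeta5)" and ?E2 = "euler_prod q (zeta5\<^sup>2) * euler_prod q (inverse (zeta5\<^sup>2))"
  note P = euler_product[OF q n(1)] euler_product[OF q n(2)] euler_product[OF q n(3)] euler_product[OF q n(4)]
  have pw: "q ^ (2 * Suc n) = (q ^ Suc n)\<^sup>2" for n
    by (metis mult.commute power_mult)
  have "(\<lambda>n. (1 + of_real ((1 + sqrt 5) / 2) * q ^ Suc n + q ^ (2 * Suc n)) ^ 5
         / (1 + of_real ((1 - sqrt 5) / 2) * q ^ Suc n + q ^ (2 * Suc n)) ^ 5) has_prod (?E2 ^ 5 / ?E1 ^ 5)"
    unfolding pw golden_factors
    by (intro has_prod_divide has_prod_power has_prod_mult P)
  then have "f_fun \<tau> = root_plus * (?E2 ^ 5 / ?E1 ^ 5)"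
    unfolding f_fun_def Let_def q_def[symmetric] has_prod_iff by simp
  moreover have nz: "euler_prod q X \<noteq> 0" for X by (simp add: euler_prod_def)
  have e: "exp (lambert (weight1_coeff (zeta5\<^sup>2)) q) = (euler_prod q 1)\<^sup>2 * ?E1\<^sup>2 / ?E2 ^ 3"
    using exp_weight1_coeff[OF q n(3), unfolded zeta5_angles(8)[symmetric] inverse_inverse_eq]
    by (simp only: mult.commute)
  note e1 = exp_weight1_coeff[OF q n(1)]
  note w = weight1_products[OF q]
  show a: "3 * rho_zeta q + rho_zeta2 q \<noteq> 0" unfolding w using root_mu(2) by simp
  show b: "3 * rho_zeta2 q - rho_zeta q \<noteq> 0" unfolding w using root_mu(3) by simp
  have R: "?E2 ^ 5 / ?E1 ^ 5 * exp (lambert (weight1_coeff (zeta5\<^sup>2)) q) = exp (lambert (weight1_coeff zeta5) q)"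
    unfolding e e1 using nz by (simp add: field_simps eval_nat_numeral)
  have "root_plus * (?E2 ^ 5 / ?E1 ^ 5) * (3 * rho_zeta2 q - rho_zeta q) = - (3 * rho_zeta q + rho_zeta2 q)"
  proof -
    have "r * R * (m * E) = (r * m) * (R * E)" for r R m E :: complex by simp
    then show ?thesis
      unfolding w by (simp only: root_mu(1) R mult_minus_left)
  qed
  ultimately show "f_fun \<tau> = - (3 * rho_zeta q + rho_zeta2 q) / (3 * rho_zeta2 q - rho_zeta q)"
    using b by (simp add: field_simps)
qed

text \<open>Only proportionality is recorded, because the differential equation is linear and homogeneous in \<open>T\<close>.\<close>

lemma T_fun_eq:
  obtains k where "\<And>\<tau>. \<tau> \<in> upper_half_plane \<Longrightarrow> T_fun \<tau> = k * (3 * rho_zeta (nome \<tau>) + rho_zeta2 (nome \<tau>))"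
proof
  fix \<tau> assume t: "\<tau> \<in> upper_half_plane"
  define q where "q = nome \<tau>"
  have q: "norm q < 1" unfolding q_def by (rule nome_norm[OF t])
  have n: "norm zeta5 = 1" "norm (inverse zeta5) = 1" "norm (zeta5\<^sup>2) = 1" "norm (inverse (zeta5\<^sup>2)) = 1" "norm (1 :: complex) = 1"
    using zeta5_facts(1) by (auto simp: norm_inverse norm_power)
  let ?E1 = "euler_prod q zeta5 * euler_prod q (inverse zeta5)" and ?E2 = "euler_prod q (zeta5\<^sup>2) * euler_prod q (inverse (zeta5\<^sup>2))"
  note P = euler_product[OF q n(1)] euler_product[OF q n(2)] euler_product[OF q n(3)] euler_product[OF q n(4)] euler_product[OF q n(5)]
  have pw: "q ^ (2 * Suc n) = (q ^ Suc n)\<^sup>2" "q ^ (5 * Suc n) = (q ^ Suc n) ^ 5" for n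
    by (metis mult.commute power_mult)+
  have "(\<lambda>n. (1 - 1 * q ^ Suc n) ^ 5 / (1 - q ^ (5 * Suc n)) ^ 3
         * (1 + of_real ((1 + sqrt 5) / 2) * q ^ Suc n + q ^ (2 * Suc n)) ^ 5)
     has_prod ((euler_prod q 1) ^ 5 / (euler_prod q 1 * ?E1 * ?E2) ^ 3 * ?E2 ^ 5)"
    unfolding pw golden_factors
    by (intro has_prod_divide has_prod_power has_prod_mult P)
  then have T: "T_fun \<tau> = of_real (sqrt (250 + 110 * sqrt 5) / 5) * ((euler_prod q 1) ^ 5 / (euler_prod q 1 * ?E1 * ?E2) ^ 3 * ?E2 ^ 5)"
    unfolding T_fun_def Let_def q_def[symmetric] has_prod_iff by simp
  have nz: "euler_prod q X \<noteq> 0" for X by (simp add: euler_prod_def)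
  have M: "K * E = K / m * (m * E)" if "m \<noteq> 0" for K m E :: complex using that by simp
  have "(euler_prod q 1) ^ 5 / (euler_prod q 1 * ?E1 * ?E2) ^ 3 * ?E2 ^ 5 = exp (lambert (weight1_coeff zeta5) q)"
    unfolding exp_weight1_coeff[OF q n(1)] using nz by (simp add: field_simps eval_nat_numeral)
  note Ex = this
  show "T_fun \<tau> = of_real (sqrt (250 + 110 * sqrt 5) / 5) / (3 * mu zeta5 + mu (zeta5\<^sup>2)) * (3 * rho_zeta (nome \<tau>) + rho_zeta2 (nome \<tau>))"
    unfolding T q_def[symmetric] weight1_products[OF q] Ex by (rule M[OF root_mu(2)])
qed

lemma has_field_derivative_nome: "(nome has_field_derivative (2 * of_real pi * \<i>) * nome \<tau>) (at \<tau>)"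
  unfolding nome_def[abs_def] by (auto intro!: derivative_eq_intros)

lemma has_field_derivative_lambert_nome:
  assumes "\<tau> \<in> upper_half_plane" "subexp c"
  shows "((\<lambda>\<tau>. lambert c (nome \<tau>)) has_field_derivative
     (2 * of_real pi * \<i>) * lambert2 (\<lambda>a. of_nat a * c a) (nome \<tau>)) (at \<tau>)"
proof -
  obtain D where D: "(lambert c has_field_derivative D) (at (nome \<tau>))"
    "nome \<tau> * D = lambert2 (\<lambda>a. of_nat a * c a) (nome \<tau>)"
    using has_field_derivative_lambert[OF assms(2) nome_norm[OF assms(1)]] .
  have "((\<lambda>\<tau>. lambert c (nome \<tau>)) has_field_derivative D * ((2 * of_real pi * \<i>) * nome \<tau>)) (at \<tau>)"
    by (rule DERIV_chain2[OF D(1) has_field_derivative_nome])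
  then show ?thesis by (simp add: D(2)[symmetric] mult_ac)
qed

text \<open>The logarithmic derivative of \<open>T\<close> under \<open>q d/dq\<close>, with the weight two Eisenstein series eliminated
by the quintic relations. In this form only series of the type \<open>lambert\<close> occur, and these can be
differentiated with respect to \<open>q\<close>.\<close>

definition dlog_T :: "complex \<Rightarrow> complex" where
  "dlog_T q = (rho1 q zeta5 - 3 * rho1 q (zeta5\<^sup>2) + (rho_zeta q)\<^sup>2 - 4 * rho_zeta q * rho_zeta2 q + 3 * (rho_zeta2 q)\<^sup>2) / 2"

text \<open>The differential system satisfied by the two weight one forms. The heat equation and its derivative give
the derivatives of \<open>\<rho>\<close> and \<open>\<rho>\<^sub>1\<close> with respect to \<open>\<tau>\<close>; what is left are polynomial identities modulo
the quintic relations. The common factors in the steps clear the denominators.\<close>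

lemma derivatives:
  assumes t: "\<tau> \<in> upper_half_plane"
  defines "q \<equiv> nome \<tau>" and "\<kappa> \<equiv> 2 * of_real pi * \<i>"
  defines "u \<equiv> 3 * rho_zeta q + rho_zeta2 q" and "v \<equiv> 3 * rho_zeta2 q - rho_zeta q"
  shows "((\<lambda>\<tau>. 3 * rho_zeta (nome \<tau>) + rho_zeta2 (nome \<tau>)) has_field_derivative \<kappa> * (u * dlog_T q)) (at \<tau>)"
    and "((\<lambda>\<tau>. 3 * rho_zeta2 (nome \<tau>) - rho_zeta (nome \<tau>)) has_field_derivative \<kappa> * (v * (dlog_T q + (u\<^sup>2 + 11 * u * v - v\<^sup>2) / 5))) (at \<tau>)"
    and "((\<lambda>\<tau>. dlog_T (nome \<tau>)) has_field_derivative \<kappa> * ((dlog_T q)\<^sup>2 - (3 * u * v - v\<^sup>2) * (u\<^sup>2 + 11 * u * v - v\<^sup>2) / 25)) (at \<tau>)"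
proof -
  have q: "norm q < 1" unfolding q_def by (rule nome_norm[OF t])
  have n: "norm zeta5 = 1" "norm (zeta5\<^sup>2) = 1" using zeta5_facts(1) by (auto simp: norm_power)
  have a: "((\<lambda>\<tau>. rho_zeta (nome \<tau>)) has_field_derivative \<kappa> * cosine_series 1 q zeta5) (at \<tau>)"
    unfolding rho_zeta_def rho_def q_def \<kappa>_def
    using has_field_derivative_lambert_nome[OF t subexp_wave[OF n(1), of 0]]
    by (auto intro!: derivative_eq_intros simp: index_times_wave)
  have b: "((\<lambda>\<tau>. rho_zeta2 (nome \<tau>)) has_field_derivative \<kappa> * cosine_series 1 q (zeta5\<^sup>2)) (at \<tau>)"
    unfolding rho_zeta2_def rho_def q_def \<kappa>_def
    using has_field_derivative_lambert_nome[OF t subexp_wave[OF n(2), of 0]]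
    by (auto intro!: derivative_eq_intros simp: index_times_wave)
  have p1: "((\<lambda>\<tau>. rho1 (nome \<tau>) zeta5) has_field_derivative \<kappa> * cosine_series 2 q zeta5) (at \<tau>)"
    unfolding rho1_def q_def \<kappa>_def
    using has_field_derivative_lambert_nome[OF t subexp_wave[OF n(1), of 1]]
    by (auto intro!: derivative_eq_intros simp: index_times_wave numeral_2_eq_2)
  have p2: "((\<lambda>\<tau>. rho1 (nome \<tau>) (zeta5\<^sup>2)) has_field_derivative \<kappa> * cosine_series 2 q (zeta5\<^sup>2)) (at \<tau>)"
    unfolding rho1_def q_def \<kappa>_def
    using has_field_derivative_lambert_nome[OF t subexp_wave[OF n(2), of 1]]
    by (auto intro!: derivative_eq_intros simp: index_times_wave numeral_2_eq_2)
  note R = quintic_relations[OF q zeta5_angles(4,5), unfolded zeta5_angles(1,2), folded rho_zeta_def rho_zeta2_def]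
  note h1 = heat_1[OF q zeta5_angles(4), unfolded zeta5_angles(1), folded rho_zeta_def]
    heat_1[OF q zeta5_angles(6), unfolded zeta5_angles(2), folded rho_zeta2_def]
  note h2 = heat_2[OF q zeta5_angles(4), unfolded zeta5_angles(1), folded rho_zeta_def]
    heat_2[OF q zeta5_angles(6), unfolded zeta5_angles(2), folded rho_zeta2_def]
  have y: "2 * dlog_T q = rho1 q zeta5 - 3 * rho1 q (zeta5\<^sup>2) + (rho_zeta q)\<^sup>2 - 4 * rho_zeta q * rho_zeta2 q + 3 * (rho_zeta2 q)\<^sup>2"
    by (simp add: dlog_T_def)
  have 1: "3 * cosine_series 1 q zeta5 + cosine_series 1 q (zeta5\<^sup>2) = u * dlog_T q"
  proof -
    have "2 * (3 * cosine_series 1 q zeta5 + cosine_series 1 q (zeta5\<^sup>2)) = 2 * (u * dlog_T q)"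
      unfolding u_def using y R(1,3,4) h1 by algebra
    then show ?thesis unfolding mult_cancel_left by simp
  qed
  show "((\<lambda>\<tau>. 3 * rho_zeta (nome \<tau>) + rho_zeta2 (nome \<tau>)) has_field_derivative \<kappa> * (u * dlog_T q)) (at \<tau>)"
    unfolding 1[symmetric] by (rule derivative_eq_intros a b refl)+ (simp add: algebra_simps)
  have 2: "3 * cosine_series 1 q (zeta5\<^sup>2) - cosine_series 1 q zeta5 = v * (dlog_T q + (u\<^sup>2 + 11 * u * v - v\<^sup>2) / 5)"
  proof -
    have "10 * (3 * cosine_series 1 q (zeta5\<^sup>2) - cosine_series 1 q zeta5) = 2 * (v * (5 * dlog_T q + (u\<^sup>2 + 11 * u * v - v\<^sup>2)))"
      unfolding u_def v_def using y R(1,3,4) h1 by algebra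
    also have "\<dots> = 10 * (v * (dlog_T q + (u\<^sup>2 + 11 * u * v - v\<^sup>2) / 5))" by (simp add: field_simps)
    finally show ?thesis unfolding mult_cancel_left by simp
  qed
  show "((\<lambda>\<tau>. 3 * rho_zeta2 (nome \<tau>) - rho_zeta (nome \<tau>)) has_field_derivative \<kappa> * (v * (dlog_T q + (u\<^sup>2 + 11 * u * v - v\<^sup>2) / 5))) (at \<tau>)"
    unfolding 2[symmetric] by (rule derivative_eq_intros a b refl)+ (simp add: algebra_simps)
  define Dy where "Dy = (cosine_series 2 q zeta5 - 3 * cosine_series 2 q (zeta5\<^sup>2) + 2 * rho_zeta q * cosine_series 1 q zeta5 - 4 * (cosine_series 1 q zeta5 * rho_zeta2 q + rho_zeta q * cosine_series 1 q (zeta5\<^sup>2))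
       + 6 * rho_zeta2 q * cosine_series 1 q (zeta5\<^sup>2)) / 2"
  have 3: "Dy = (dlog_T q)\<^sup>2 - (3 * u * v - v\<^sup>2) * (u\<^sup>2 + 11 * u * v - v\<^sup>2) / 25"
  proof -
    have D2: "2 * Dy = cosine_series 2 q zeta5 - 3 * cosine_series 2 q (zeta5\<^sup>2) + 2 * rho_zeta q * cosine_series 1 q zeta5 - 4 * (cosine_series 1 q zeta5 * rho_zeta2 q + rho_zeta q * cosine_series 1 q (zeta5\<^sup>2))
       + 6 * rho_zeta2 q * cosine_series 1 q (zeta5\<^sup>2)" by (simp add: Dy_def)
    have "300 * Dy = 12 * (25 * (dlog_T q)\<^sup>2 - (3 * u * v - v\<^sup>2) * (u\<^sup>2 + 11 * u * v - v\<^sup>2))"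
      unfolding u_def v_def using D2 y R(1,3-6) h1 h2 by algebra
    also have "\<dots> = 300 * ((dlog_T q)\<^sup>2 - (3 * u * v - v\<^sup>2) * (u\<^sup>2 + 11 * u * v - v\<^sup>2) / 25)" by (simp add: field_simps)
    finally show ?thesis unfolding mult_cancel_left by simp
  qed
  have "((\<lambda>\<tau>. dlog_T (nome \<tau>)) has_field_derivative \<kappa> * Dy) (at \<tau>)"
  proof -
    have "((\<lambda>\<tau>. rho1 (nome \<tau>) zeta5 - 3 * rho1 (nome \<tau>) (zeta5\<^sup>2) + rho_zeta (nome \<tau>) * rho_zeta (nome \<tau>)
        - 4 * (rho_zeta (nome \<tau>) * rho_zeta2 (nome \<tau>)) + 3 * (rho_zeta2 (nome \<tau>) * rho_zeta2 (nome \<tau>))) has_field_derivative \<kappa> * (2 * Dy)) (at \<tau>)"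
      by (rule derivative_eq_intros a b p1 p2 refl)+ (simp add: Dy_def q_def[symmetric] algebra_simps)
    from DERIV_cdivide[OF this, of 2] show ?thesis
      by (simp add: dlog_T_def power2_eq_square mult.assoc)
  qed
  then show "((\<lambda>\<tau>. dlog_T (nome \<tau>)) has_field_derivative \<kappa> * ((dlog_T q)\<^sup>2 - (3 * u * v - v\<^sup>2) * (u\<^sup>2 + 11 * u * v - v\<^sup>2) / 25)) (at \<tau>)"
    unfolding 3 .
qed

section \<open>The differential equation\<close>

lemma roots_sum_product:
  "root_plus + root_minus = 11" "root_plus * root_minus = - 1"
proof -
  have "(11 + 5 * sqrt 5) / 2 + (11 - 5 * sqrt 5) / 2 = 11" by (simp add: field_simps)
  then show "root_plus + root_minus = 11"
    unfolding root_plus_def root_minus_def of_real_add[symmetric] by (simp only: of_real_numeral)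
  have "(11 + 5 * sqrt 5) / 2 * ((11 - 5 * sqrt 5) / 2) = - 1" by (simp add: algebra_simps)
  then show "root_plus * root_minus = - 1"
    unfolding root_plus_def root_minus_def of_real_mult[symmetric] by (simp only: of_real_minus of_real_1)
qed

text \<open>Here \<open>d\<close> stands for \<open>d\<tau>/df\<close> times \<open>2 \<pi> \<i>\<close>, \<open>Q\<close> for \<open>f\<^sup>2 - 11 f - 1\<close> and \<open>R\<close> for its derivative; the left
side is the differential operator applied to \<open>T = k u\<close>, with the derivatives of \<open>T\<close> written out.\<close>

lemma ode_cancellation:
  fixes f v y k Q R d :: complex
  assumes nz: "f \<noteq> 0" "v \<noteq> 0" "Q \<noteq> 0" and d: "d * (f * v\<^sup>2 * Q) = - 5" and u: "u = - f * v"
  shows "((- 5 * k) * ((d * (y\<^sup>2 - (3 * u * v - v\<^sup>2) * (v\<^sup>2 * Q) / 25) * f + y) * (u * Q)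
      - y * f * (d * (u * y) * Q + u * R))) / ((u * Q) * (u * Q))
     + (- (1 / f) + R / Q) * (- 5 * k * y * f / (u * Q))
     - (3 * f + 1) / (f\<^sup>2 * Q) * (k * u) = 0"
proof -
  have d: "d = - 5 / (f * v\<^sup>2 * Q)" using d nz by (simp add: field_simps)
  show ?thesis unfolding d u using nz
    by (simp add: divide_simps) algebra
qed

theorem proposition6p7:
  fixes U :: "complex set" and \<tau> Tf :: "complex \<Rightarrow> complex"
  assumes "local_holomorphic_inverse f_fun upper_half_plane U \<tau>"
  defines "Tf \<equiv> (\<lambda>f. T_fun (\<tau> f))"
  shows "Tf holomorphic_on U \<and>
    (\<forall>f\<in>U.
       deriv (deriv Tf) f
       + (- (1 / f) + 1 / (f - root_plus) + 1 / (f - root_minus)) * deriv Tf f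
       - (3 * f + 1) / (f ^ 2 * (f - root_plus) * (f - root_minus)) * Tf f = 0)"
proof -
  define \<kappa> :: complex where "\<kappa> = 2 * of_real pi * \<i>"
  define u where "u = (\<lambda>f. 3 * rho_zeta (nome (\<tau> f)) + rho_zeta2 (nome (\<tau> f)))"
  define v where "v = (\<lambda>f. 3 * rho_zeta2 (nome (\<tau> f)) - rho_zeta (nome (\<tau> f)))"
  define y where "y = (\<lambda>f. dlog_T (nome (\<tau> f)))"
  have U: "open U" "\<tau> holomorphic_on U" and H: "\<And>f. f \<in> U \<Longrightarrow> \<tau> f \<in> upper_half_plane"
    and inv: "\<And>f. f \<in> U \<Longrightarrow> f_fun (\<tau> f) = f"
    using assms(1) unfolding local_holomorphic_inverse_def by auto
  obtain k where k: "\<And>\<tau>. \<tau> \<in> upper_half_plane \<Longrightarrow> T_fun \<tau> = k * (3 * rho_zeta (nome \<tau>) + rho_zeta2 (nome \<tau>))"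
    using T_fun_eq by blast
  have Tf: "Tf f = k * u f" if "f \<in> U" for f
    unfolding Tf_def u_def by (rule k[OF H[OF that]])
  have nz: "u f \<noteq> 0" "v f \<noteq> 0" "u f = - f * v f" "f \<noteq> 0" if "f \<in> U" for f
  proof -
    show n: "u f \<noteq> 0" "v f \<noteq> 0" unfolding u_def v_def using f_fun_eq(2,3)[OF H[OF that]] .
    have "f = - u f / v f" using f_fun_eq(1)[OF H[OF that]] inv[OF that] by (simp add: u_def v_def)
    then show uv: "u f = - f * v f" using n by (simp add: field_simps)
    then show "f \<noteq> 0" using n by auto
  qed
  define Q where "Q = (\<lambda>f::complex. f\<^sup>2 - 11 * f - 1)"
  have roots: "Q f = (f - root_plus) * (f - root_minus)" for f
  proof -
    have "(f - root_plus) * (f - root_minus) = f\<^sup>2 - (root_plus + root_minus) * f + root_plus * root_minus"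
      by (simp add: algebra_simps power2_eq_square)
    then show ?thesis unfolding Q_def roots_sum_product by simp
  qed
  define d where "d = (\<lambda>f. deriv \<tau> f * \<kappa>)"
  have d\<tau>: "(\<tau> has_field_derivative deriv \<tau> f) (at f)" if "f \<in> U" for f
    using U that by (simp add: holomorphic_derivI)
  have quad: "(u f)\<^sup>2 + 11 * u f * v f - (v f)\<^sup>2 = (v f)\<^sup>2 * Q f" if "f \<in> U" for f
    unfolding nz(3)[OF that] Q_def by algebra
  have Du: "(u has_field_derivative d f * (u f * y f)) (at f)" if "f \<in> U" for f
    unfolding u_def y_def d_def
    using DERIV_chain2[OF derivatives(1)[OF H[OF that]] d\<tau>[OF that]] by (simp add: \<kappa>_def mult_ac)
  have Dv: "(v has_field_derivative d f * (v f * (y f + (v f)\<^sup>2 * Q f / 5))) (at f)" if "f \<in> U" for f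
    unfolding quad[OF that, symmetric] unfolding u_def v_def y_def d_def
    using DERIV_chain2[OF derivatives(2)[OF H[OF that]] d\<tau>[OF that]] by (simp add: \<kappa>_def mult_ac)
  have Dy: "(y has_field_derivative d f * ((y f)\<^sup>2 - (3 * u f * v f - (v f)\<^sup>2) * ((v f)\<^sup>2 * Q f) / 25)) (at f)" if "f \<in> U" for f
    unfolding quad[OF that, symmetric] unfolding u_def v_def y_def d_def
    using DERIV_chain2[OF derivatives(3)[OF H[OF that]] d\<tau>[OF that]] by (simp add: \<kappa>_def mult_ac)
  \<comment> \<open>Differentiating \<open>u = - f v\<close> in two ways determines \<open>d\<tau>/df\<close>. In particular \<open>f\<close> avoids the two
    singular points, so the coefficients of the equation are honest quotients.\<close>
  have dQ: "d f * (f * (v f)\<^sup>2 * Q f) = - 5" if f: "f \<in> U" for f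
  proof -
    have "((\<lambda>f. - f * v f) has_field_derivative - 1 * v f + (d f * (v f * (y f + (v f)\<^sup>2 * Q f / 5))) * (- f)) (at f)"
      by (rule derivative_eq_intros Dv[OF f] refl)+
    moreover have "((\<lambda>f. - f * v f) has_field_derivative d f * (u f * y f)) (at f)"
      by (rule has_field_derivative_transform_within_open[OF Du[OF f] U(1) f nz(3)])
    ultimately have "- 1 * v f + (d f * (v f * (y f + (v f)\<^sup>2 * Q f / 5))) * (- f) = d f * (u f * y f)"
      by (rule DERIV_unique)
    then have "v f * (d f * (f * (v f)\<^sup>2 * Q f)) = v f * (- 5)"
      unfolding nz(3)[OF f] by (simp add: field_simps) (metis add.commute eq_neg_iff_add_eq_0)
    then show ?thesis unfolding mult_cancel_left using nz(2)[OF f] by simp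
  qed
  have Qnz: "Q f \<noteq> 0" if "f \<in> U" for f using dQ[OF that] by auto
  define g where "g = (\<lambda>f. - 5 * k * y f * f / (u f * Q f))"
  have DT: "(Tf has_field_derivative g f) (at f)" if f: "f \<in> U" for f
  proof -
    have "((\<lambda>f. k * u f) has_field_derivative k * (d f * (u f * y f))) (at f)"
      by (rule derivative_eq_intros Du[OF f] refl)+ simp
    moreover have "k * (d f * (u f * y f)) = g f"
    proof -
      have "(k * (d f * (u f * y f))) * (u f * Q f) = k * y f * f * (d f * (f * (v f)\<^sup>2 * Q f))"
        unfolding nz(3)[OF f] by algebra
      then have "(k * (d f * (u f * y f))) * (u f * Q f) = - 5 * k * y f * f" unfolding dQ[OF f] by simp
      then show ?thesis unfolding g_def using nz(1)[OF f] Qnz[OF f] by (simp add: field_simps)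
    qed
    ultimately have "((\<lambda>f. k * u f) has_field_derivative g f) (at f)" by simp
    then show ?thesis
      by (rule has_field_derivative_transform_within_open[OF _ U(1) f]) (simp add: Tf)
  qed
  have "Tf holomorphic_on U"
    using DT U(1) by (auto simp: holomorphic_on_open)
  moreover have "deriv (deriv Tf) f
       + (- (1 / f) + 1 / (f - root_plus) + 1 / (f - root_minus)) * deriv Tf f
       - (3 * f + 1) / (f ^ 2 * (f - root_plus) * (f - root_minus)) * Tf f = 0" if f: "f \<in> U" for f
  proof -
    note n = nz[OF f] Qnz[OF f]
    let ?Y = "d f * ((y f)\<^sup>2 - (3 * u f * v f - (v f)\<^sup>2) * ((v f)\<^sup>2 * Q f) / 25)"
    have DQ: "(Q has_field_derivative 2 * f - 11) (at f)"
      unfolding Q_def[abs_def] by (auto intro!: derivative_eq_intros)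
    have "(g has_field_derivative ((- 5 * k) * ((?Y * f + y f) * (u f * Q f)
      - y f * f * (d f * (u f * y f) * Q f + u f * (2 * f - 11)))) / ((u f * Q f) * (u f * Q f))) (at f)"
      unfolding g_def
      by (rule derivative_eq_intros Dy[OF f] Du[OF f] DQ refl | use n in \<open>simp add: algebra_simps\<close>)+
    then have "(deriv Tf has_field_derivative ((- 5 * k) * ((?Y * f + y f) * (u f * Q f)
      - y f * f * (d f * (u f * y f) * Q f + u f * (2 * f - 11)))) / ((u f * Q f) * (u f * Q f))) (at f)"
      by (rule has_field_derivative_transform_within_open[OF _ U(1) f]) (simp add: DERIV_imp_deriv[OF DT])
    then have D2: "deriv (deriv Tf) f = ((- 5 * k) * ((?Y * f + y f) * (u f * Q f)
      - y f * f * (d f * (u f * y f) * Q f + u f * (2 * f - 11)))) / ((u f * Q f) * (u f * Q f))"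
      by (rule DERIV_imp_deriv)
    have D1: "deriv Tf f = - 5 * k * y f * f / (u f * Q f)"
      using DERIV_imp_deriv[OF DT[OF f]] by (simp add: g_def)
    have rn: "f - root_plus \<noteq> 0" "f - root_minus \<noteq> 0" using n(5) unfolding roots by auto
    have P: "- (1 / f) + 1 / (f - root_plus) + 1 / (f - root_minus) = - (1 / f) + (2 * f - 11) / Q f"
    proof -
      have "1 / (f - root_plus) + 1 / (f - root_minus) = (2 * f - (root_plus + root_minus)) / Q f"
        unfolding roots using rn by (simp add: divide_simps)
      then show ?thesis unfolding roots_sum_product by simp
    qed
    have R: "f ^ 2 * (f - root_plus) * (f - root_minus) = f\<^sup>2 * Q f" by (simp add: roots)
    show ?thesis
      unfolding D1 D2 P R Tf[OF f]
      by (rule ode_cancellation[OF n(4,2,5) dQ[OF f] n(3)])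
  qed
  ultimately show ?thesis by blast
qed

end
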